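(* Let $y$ be the solution of $\dot y(t)=f(y(t),y(\lfloor t\rfloor))$, $t\in[0,b]$, $y(0)=y_0\in\mathbb{R}^m$, with $f:\mathbb{R}^m\times\mathbb{R}^m\to\mathbb{R}^m$ of class $C^\infty$. Let $h=1/\nu$ with $\nu$ a positive integer, $t_n=nh$ for $n=0,\dots,N$, $N=K\nu$, $b=Nh=K$, with $K$ a fixed positive integer. Let $s\ge1$ be an integer and let $\sigma$ be the piecewise polynomial approximation of degree at most $s$ on each $[t_{n-1},t_n]$ defined by $\sigma(0)=y_0$ and, with $\sigma_n(ch):=\sigma(t_{n-1}+ch)$, by $$\dot\sigma_n(ch)=\sum_{j=0}^{s-1}P_j(c)\,\gamma_j^{\,n},\quad c\in[0,1],\qquad \sigma_n(0)=\sigma(t_{n-1}),$$ $$\gamma_j^{\,n}=\int_0^1P_j(\zeta)\,f\bigl(\sigma_n(\zeta h),\sigma(\lfloor (n-1)/\nu\rfloor)\bigr)\,d\zeta,\qquad n=1,\dots,N .$$ Then, for $n=1,\dots,N$, $$y(t_n)-\sigma(t_n)=y(t_{n-1})-\sigma(t_{n-1})+O(h^{2s+1}),$$ $$y(t_{n-1}+ch)-\sigma(t_{n-1}+ch)=O(h^{s+1}),\qquad c\in(0,1).$$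
   Context: $\lfloor\cdot\rfloor$ is the floor function. A solution $y$ is continuous on $[0,b]$ and satisfies the equation on each $[n,n+1)\subseteq[0,b]$ with integer $n$ (one-sided derivatives at integers). $\{P_j\}_{j\ge0}$ are the shifted and scaled Legendre polynomials on $[0,1]$: $P_j$ has degree $j$ and $\int_0^1P_i(x)P_j(x)\,dx=\delta_{ij}$. The dot is the derivative with respect to time, so that $\sigma_n(ch)=\sigma_n(0)+h\sum_{j=0}^{s-1}\int_0^cP_j(x)\,dx\,\gamma_j^{\,n}$. On $[t_{n-1},t_n)$ one has $\lfloor t\rfloor=\lfloor (n-1)/\nu\rfloor$, so $\sigma(\lfloor (n-1)/\nu\rfloor)$ is the constant memory term. The solution $y$ is assumed to exist on $[0,b]$ and $\sigma$ is assumed to be uniquely defined for all sufficiently small $h$. The $O$ symbols refer to $h=1/\nu\to0$ with constants independent of $n$. *)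

theory Defs
  imports "HOL-Analysis.Analysis" "HOL-Computational_Algebra.Polynomial"
begin

(* On finite-dimensional spaces this is the usual class of k times continuously
   differentiable maps: all directional derivatives are again of class k - 1, so
   directions range over the whole space, in particular over a basis. *)
primrec Ck :: "nat \<Rightarrow> ('a::euclidean_space \<Rightarrow> 'b::euclidean_space) \<Rightarrow> bool" where
  "Ck 0 f \<longleftrightarrow> continuous_on UNIV f"
| "Ck (Suc k) f \<longleftrightarrow> (\<forall>x. f differentiable (at x)) \<and>
     (\<forall>v. Ck k (\<lambda>x. frechet_derivative f (at x) v))"

definition C_inf :: "('a::euclidean_space \<Rightarrow> 'b::euclidean_space) \<Rightarrow> bool" where
  "C_inf f \<longleftrightarrow> (\<forall>k. Ck k f)"

(* These conditions determine each P j up to its sign. *)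
definition orthonormal_legendre :: "(nat \<Rightarrow> real poly) \<Rightarrow> bool" where
  "orthonormal_legendre P \<longleftrightarrow>
     (\<forall>j. degree (P j) = j) \<and>
     (\<forall>i j. integral {0..1} (\<lambda>x. poly (P i) x * poly (P j) x) = (if i = j then 1 else 0))"

(* The derivative is taken within [n, n+1), hence it is the right derivative at integers.
   Nothing is imposed on y outside [0, K]. *)
definition EPCA_solution ::
  "((real^'m) \<times> (real^'m) \<Rightarrow> real^'m) \<Rightarrow> real^'m \<Rightarrow> nat \<Rightarrow> (real \<Rightarrow> real^'m) \<Rightarrow> bool" where
  "EPCA_solution f y0 K y \<longleftrightarrow>
     y 0 = y0 \<and>
     continuous_on {0..real K} y \<and>
     (\<forall>n<K. \<forall>t\<in>{real n..<real n + 1}.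
        (y has_vector_derivative f (y t, y (of_int \<lfloor>t\<rfloor>))) (at t within {real n..<real n + 1}))"

definition step :: "nat \<Rightarrow> real" where
  "step \<nu> = 1 / real \<nu>"

definition grid :: "nat \<Rightarrow> nat \<Rightarrow> real" where
  "grid \<nu> n = real n * step \<nu>"

definition gam ::
  "((real^'m) \<times> (real^'m) \<Rightarrow> real^'m) \<Rightarrow> (nat \<Rightarrow> real poly) \<Rightarrow> nat \<Rightarrow> (real \<Rightarrow> real^'m)
     \<Rightarrow> nat \<Rightarrow> nat \<Rightarrow> real^'m" where
  "gam f P \<nu> \<sigma> n j =
     integral {0..1} (\<lambda>\<zeta>. poly (P j) \<zeta> *\<^sub>R
       f (\<sigma> (grid \<nu> (n - 1) + \<zeta> * step \<nu>), \<sigma> (of_int \<lfloor>real (n - 1) / real \<nu>\<rfloor>)))"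

(* The pieces live on closed intervals that share their end points, so the initial value of
   each piece is the final value of the preceding one.  The derivative is with respect to
   time (not with respect to c), one-sided at the end points of each piece. *)
definition poly_approx ::
  "((real^'m) \<times> (real^'m) \<Rightarrow> real^'m) \<Rightarrow> real^'m \<Rightarrow> nat \<Rightarrow> (nat \<Rightarrow> real poly) \<Rightarrow> nat \<Rightarrow> nat
     \<Rightarrow> (real \<Rightarrow> real^'m) \<Rightarrow> bool" where
  "poly_approx f y0 K P s \<nu> \<sigma> \<longleftrightarrow>
     \<sigma> 0 = y0 \<and>
     (\<forall>n\<in>{1..K * \<nu>}.
        (\<exists>q :: 'm \<Rightarrow> real poly. (\<forall>i. degree (q i) \<le> s) \<and>
           (\<forall>t\<in>{grid \<nu> (n - 1)..grid \<nu> n}. \<sigma> t = (\<chi> i. poly (q i) t))) \<and>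
        (\<forall>c\<in>{0..1}.
           (\<sigma> has_vector_derivative (\<Sum>j<s. poly (P j) c *\<^sub>R gam f P \<nu> \<sigma> n j))
             (at (grid \<nu> (n - 1) + c * step \<nu>) within {grid \<nu> (n - 1)..grid \<nu> n})))"

(* Functions on [0, K] are represented by total functions, so uniqueness is up to
   their values outside [0, K]. *)
definition unique_poly_approx ::
  "((real^'m) \<times> (real^'m) \<Rightarrow> real^'m) \<Rightarrow> real^'m \<Rightarrow> nat \<Rightarrow> (nat \<Rightarrow> real poly) \<Rightarrow> nat \<Rightarrow> nat
     \<Rightarrow> (real \<Rightarrow> real^'m) \<Rightarrow> bool" where
  "unique_poly_approx f y0 K P s \<nu> \<sigma> \<longleftrightarrow>
     poly_approx f y0 K P s \<nu> \<sigma> \<and>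
     (\<forall>\<tau>. poly_approx f y0 K P s \<nu> \<tau> \<longrightarrow> (\<forall>t\<in>{0..real K}. \<tau> t = \<sigma> t))"

end

theory Submission
  imports Defs
begin

text \<open>
On each step write \<open>u(c) = y(t + ch)\<close> and \<open>w(c) = \<sigma>(t + ch)\<close>. The derivative of \<open>w\<close> is \<open>h\<close> times the orthogonal projection of
\<open>f(w, S)\<close> onto polynomials of degree less than \<open>s\<close>, where \<open>S\<close> is the memory value. The defect
\<open>r = f(w, S) - \<Pi> f(w, S)\<close> is therefore orthogonal to all polynomials of degree less than \<open>s\<close>. It is of order
\<open>h ^ s\<close>, up to inherited errors, because \<open>f(u, Y)\<close>, with the exact memory value \<open>Y\<close>, is close to its Taylor polynomial and
\<open>w\<close> is close to \<open>u\<close>. Integrating once shows that the error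
\<open>e = u - w\<close> is of order \<open>h ^ (s + 1)\<close> inside a step, again up to inherited errors (\<open>step_error_sup\<close>).

At the end of the step the orthogonality counts. Linearized along the smooth curve \<open>u\<close>, the error
equation is \<open>e' = h (A e + r)\<close> up to terms of higher order, and \<open>A\<close> is a polynomial in \<open>h (1 - c)\<close> up to \<open>O(h ^ s)\<close>.
Repeated integration by parts of the moments \<open>\<integral> (1 - c) ^ k e\<close> trades each moment for higher
ones, with a gain of a power of \<open>h\<close>, and pairs the defect only with polynomials; as long as their degree is below \<open>s\<close>
these terms vanish, and after that \<open>s\<close> powers of \<open>h\<close> have been gained on top of the size
\<open>h ^ s\<close> of the defect. So the nodal error grows by at most \<open>C h (D + h ^ (2 s))\<close> in one step, where \<open>D\<close> is the
error at the start of the step plus the error in the memory value (\<open>weighted_moment_bound\<close>, \<open>one_step_error\<close>).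
A discrete Gronwall inequality then makes all nodal errors \<open>O(h ^ (2 s))\<close>, and one step changes
them by \<open>O(h ^ (2 s + 1))\<close> (\<open>approx_error_bounds\<close>).

The constants depend on a ball that contains both \<open>y\<close> and the approximation. As \<open>f\<close> need not be globally
Lipschitz, the discrete equations could have solutions far away from \<open>y\<close>. But a fixed point argument, repeated on
each step, constructs an approximation that remains near \<open>y\<close> (\<open>approx_in_tube_exists\<close>), and by
uniqueness this is \<open>\<sigma>\<close>.
\<close>

section \<open>Smooth maps and Taylor expansion along a flow\<close>

lemma Ck_SucD: "Ck (Suc k) f \<Longrightarrow> Ck k f"
proof (induction k arbitrary: f)
  case 0
  then show ?case
    by (auto intro!: differentiable_imp_continuous_on simp: differentiable_on_def differentiable_at_withinI)
next
  case (Suc k)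
  then show ?case by (metis Ck.simps(2))
qed

lemma frechet_derivative_eqI:
  "(f has_derivative f') (at x) \<Longrightarrow> frechet_derivative f (at x) = f'"
  by (rule frechet_derivative_at[symmetric])

lemma Ck_const: "Ck k (\<lambda>x. c)"
proof (induction k arbitrary: c)
  case (Suc k)
  have "frechet_derivative (\<lambda>x. c) (at x) = (\<lambda>v. 0)" for x :: 'a
    by (rule frechet_derivative_eqI) simp
  then show ?case using Suc by simp
qed simp

lemma Ck_add: "Ck k f \<Longrightarrow> Ck k g \<Longrightarrow> Ck k (\<lambda>x. f x + g x)"
proof (induction k arbitrary: f g)
  case 0
  then show ?case by (simp add: continuous_on_add)
next
  case (Suc k)
  have "frechet_derivative (\<lambda>x. f x + g x) (at x)
      = (\<lambda>v. frechet_derivative f (at x) v + frechet_derivative g (at x) v)" for x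
    using Suc.prems by (intro frechet_derivative_eqI has_derivative_add)
      (auto simp: frechet_derivative_works[symmetric])
  then show ?case using Suc by simp
qed

lemma Ck_sum: "(\<And>b. b \<in> B \<Longrightarrow> Ck k (g b)) \<Longrightarrow> Ck k (\<lambda>x. \<Sum>b\<in>B. g b x)"
  by (induction B rule: infinite_finite_induct) (simp_all add: Ck_const Ck_add)

lemma Ck_scaleR: "Ck k a \<Longrightarrow> Ck k g \<Longrightarrow> Ck k (\<lambda>x. a x *\<^sub>R g x)"
proof (induction k arbitrary: a g)
  case 0
  then show ?case by (simp add: continuous_on_scaleR)
next
  case (Suc k)
  have "frechet_derivative (\<lambda>x. a x *\<^sub>R g x) (at x)
      = (\<lambda>v. a x *\<^sub>R frechet_derivative g (at x) v + frechet_derivative a (at x) v *\<^sub>R g x)" for x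
    using Suc.prems by (intro frechet_derivative_eqI has_derivative_scaleR)
      (auto simp: frechet_derivative_works[symmetric])
  moreover have "Ck k a" "Ck k g" using Suc.prems Ck_SucD by blast+
  ultimately show ?case using Suc by (auto intro!: Ck_add)
qed

lemma Ck_bounded_linear: "bounded_linear L \<Longrightarrow> Ck k f \<Longrightarrow> Ck k (\<lambda>x. L (f x))"
proof (induction k arbitrary: f)
  case 0
  then show ?case by (simp add: bounded_linear.continuous_on)
next
  case (Suc k)
  have "frechet_derivative (\<lambda>x. L (f x)) (at x) = (\<lambda>v. L (frechet_derivative f (at x) v))" for x
    using Suc.prems(2) by (intro frechet_derivative_eqI bounded_linear.has_derivative[OF Suc.prems(1)])
      (auto simp: frechet_derivative_works[symmetric])
  moreover have "(\<lambda>x. L (f x)) differentiable at x" for x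
    using Suc.prems(2) bounded_linear.has_derivative[OF Suc.prems(1)]
    unfolding differentiable_def Ck.simps by blast
  ultimately show ?case using Suc.IH[OF Suc.prems(1)] Suc.prems(2) by simp
qed

lemma C_inf_continuous: "C_inf f \<Longrightarrow> continuous_on S f"
  unfolding C_inf_def using Ck.simps(1) continuous_on_subset by blast

lemma C_inf_has_derivative:
  "C_inf f \<Longrightarrow> (f has_derivative frechet_derivative f (at x)) (at x)"
  unfolding C_inf_def by (metis Ck.simps(2) frechet_derivative_works)

lemma C_inf_frechet_derivative: "C_inf f \<Longrightarrow> C_inf (\<lambda>x. frechet_derivative f (at x) v)"
  unfolding C_inf_def by (metis Ck.simps(2))

lemma C_inf_bounded_linear: "bounded_linear L \<Longrightarrow> C_inf f \<Longrightarrow> C_inf (\<lambda>x. L (f x))"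
  unfolding C_inf_def by (simp add: Ck_bounded_linear)

text \<open>Expanding the direction in the basis reduces every estimate on a derivative to finitely many
functions, each of which is smooth by the definition of the class.\<close>
lemma frechet_derivative_basis_sum:
  assumes "C_inf g"
  shows "frechet_derivative g (at x) v = (\<Sum>b\<in>Basis. (v \<bullet> b) *\<^sub>R frechet_derivative g (at x) b)"
proof -
  have lin: "linear (frechet_derivative g (at x))"
    using C_inf_has_derivative[OF assms] has_derivative_linear by blast
  have "frechet_derivative g (at x) v = frechet_derivative g (at x) (\<Sum>b\<in>Basis. (v \<bullet> b) *\<^sub>R b)"
    by (simp add: euclidean_representation)
  then show ?thesis
    by (simp add: linear_sum[OF lin] linear_scale[OF lin])
qed

text \<open>The derivative of an observable along a vector field: if \<open>z\<close> solves \<open>z' = F z\<close> then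
\<open>g \<circ> z\<close> has derivative \<open>lie F g \<circ> z\<close>. Iterating it gives all time derivatives of
\<open>g \<circ> z\<close> as fixed smooth functions of the current state, so in a compact set they are
bounded by constants that depend neither on the trajectory nor on the step size.\<close>
definition lie :: "('a::euclidean_space \<Rightarrow> 'a) \<Rightarrow> ('a \<Rightarrow> 'b::euclidean_space) \<Rightarrow> 'a \<Rightarrow> 'b" where
  "lie F g x = frechet_derivative g (at x) (F x)"

lemma C_inf_lie:
  assumes "C_inf F" "C_inf g"
  shows "C_inf (lie F g)"
proof -
  have "C_inf (\<lambda>x. \<Sum>b\<in>Basis. (F x \<bullet> b) *\<^sub>R frechet_derivative g (at x) b)"
    using assms(1) C_inf_frechet_derivative[OF assms(2)] unfolding C_inf_def
    by (auto intro!: Ck_sum Ck_scaleR Ck_bounded_linear[OF bounded_linear_inner_left])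
  then show ?thesis
    unfolding lie_def by (subst frechet_derivative_basis_sum[OF assms(2)])
qed

lemma C_inf_lie_funpow: "C_inf F \<Longrightarrow> C_inf g \<Longrightarrow> C_inf ((lie F ^^ j) g)"
  by (induction j) (auto intro: C_inf_lie)

lemma C_inf_bounded_on_compact:
  assumes "C_inf g" "compact S"
  shows "\<exists>C\<ge>0. \<forall>x\<in>S. norm (g x) \<le> C"
proof -
  have "bounded (g ` S)"
    by (intro compact_imp_bounded compact_continuous_image C_inf_continuous assms)
  then obtain C where "\<forall>x\<in>S. norm (g x) \<le> C" by (auto simp: bounded_iff)
  then have "\<forall>x\<in>S. norm (g x) \<le> max 0 C" by fastforce
  then show ?thesis by (meson max.cobounded1)
qed

lemma finite_family_bound:
  assumes "finite A" "\<And>i. i \<in> A \<Longrightarrow> \<exists>C::real\<ge>0. \<forall>x. Q i x \<longrightarrow> N i x \<le> C"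
  shows "\<exists>C::real\<ge>0. \<forall>i\<in>A. \<forall>x. Q i x \<longrightarrow> N i x \<le> C"
proof -
  obtain C where C: "\<And>i. i \<in> A \<Longrightarrow> 0 \<le> C i \<and> (\<forall>x. Q i x \<longrightarrow> N i x \<le> C i)"
    using assms(2) by metis
  have "C i \<le> sum C A" if "i \<in> A" for i
    using that assms(1) C by (intro member_le_sum) auto
  then show ?thesis using C by (intro exI[of _ "sum C A"]) (force simp: sum_nonneg)
qed

lemma C_inf_derivative_bound:
  fixes g :: "'a::euclidean_space \<Rightarrow> 'b::euclidean_space"
  assumes "C_inf g" "compact S"
  shows "\<exists>C\<ge>0. \<forall>x\<in>S. \<forall>v. norm (frechet_derivative g (at x) v) \<le> C * norm v"
proof -
  have "\<exists>C\<ge>0. \<forall>b\<in>Basis. \<forall>x. x \<in> S \<longrightarrow> norm (frechet_derivative g (at x) b) \<le> C"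
    using C_inf_bounded_on_compact[OF C_inf_frechet_derivative[OF assms(1)] assms(2)]
    by (intro finite_family_bound) (simp_all add: Ball_def)
  then obtain C where C: "C \<ge> 0" "\<And>b x. b \<in> Basis \<Longrightarrow> x \<in> S \<Longrightarrow> norm (frechet_derivative g (at x) b) \<le> C"
    by blast
  have "norm (frechet_derivative g (at x) v) \<le> (real DIM('a) * C) * norm v" if "x \<in> S" for x v
  proof -
    have "norm (frechet_derivative g (at x) v) \<le> (\<Sum>b\<in>(Basis::'a set). norm v * C)"
      unfolding frechet_derivative_basis_sum[OF assms(1), of x v]
      by (intro sum_norm_le) (auto intro!: mult_mono C that Basis_le_norm)
    then show ?thesis by (simp add: mult_ac)
  qed
  then show ?thesis using C(1) by (intro exI[of _ "real DIM('a) * C"]) auto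
qed

lemma C_inf_lipschitz_on:
  fixes g :: "'a::euclidean_space \<Rightarrow> 'b::euclidean_space"
  assumes "C_inf g" "compact S" "convex S"
  shows "\<exists>C\<ge>0. \<forall>x\<in>S. \<forall>z\<in>S. norm (g z - g x) \<le> C * norm (z - x)"
proof -
  obtain C where C: "C \<ge> 0" "\<And>x v. x \<in> S \<Longrightarrow> norm (frechet_derivative g (at x) v) \<le> C * norm v"
    using C_inf_derivative_bound[OF assms(1,2)] by blast
  have "norm (g z - g x) \<le> C * norm (z - x)" if "x \<in> S" "z \<in> S" for x z
    by (rule differentiable_bound[OF assms(3), where f' = "\<lambda>x. frechet_derivative g (at x)"])
      (use that C(2) in \<open>auto intro!: onorm_bound C(1) has_derivative_at_withinI C_inf_has_derivative assms\<close>)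
  then show ?thesis using C(1) by blast
qed

text \<open>The map \<open>g - Dg(z)\<close> has derivative \<open>Dg(p) - Dg(z)\<close> at a point \<open>p\<close> of the segment; this
is small of first order because the partial derivatives are Lipschitz on the compact set.\<close>
lemma C_inf_quadratic_remainder:
  fixes g :: "'a::euclidean_space \<Rightarrow> 'b::euclidean_space"
  assumes "C_inf g" "compact S" "convex S"
  shows "\<exists>C\<ge>0. \<forall>x\<in>S. \<forall>z\<in>S. norm (g z - g x - frechet_derivative g (at z) (z - x)) \<le> C * norm (z - x) ^ 2"
proof -
  let ?D = "\<lambda>x. frechet_derivative g (at x)"
  have "\<exists>C\<ge>0. \<forall>b\<in>Basis. \<forall>p. fst p \<in> S \<and> snd p \<in> S \<and> fst p \<noteq> snd p \<longrightarrow>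
      norm (?D (snd p) b - ?D (fst p) b) / norm (snd p - fst p) \<le> C"
    using C_inf_lipschitz_on[OF C_inf_frechet_derivative[OF assms(1)] assms(2,3)]
    by (intro finite_family_bound) (fastforce simp: divide_simps)+
  then obtain C where C: "C \<ge> 0" "\<And>b x z. b \<in> Basis \<Longrightarrow> x \<in> S \<Longrightarrow> z \<in> S \<Longrightarrow> x \<noteq> z \<Longrightarrow>
      norm (?D z b - ?D x b) / norm (z - x) \<le> C"
    by (metis fst_conv snd_conv)
  have C': "norm (?D z b - ?D x b) \<le> C * norm (z - x)" if "b \<in> Basis" "x \<in> S" "z \<in> S" for b x z
    using C(2)[OF that] by (cases "x = z") (auto simp: divide_simps)
  have D: "norm (?D x v - ?D z v) \<le> real DIM('a) * C * norm (z - x) * norm v"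
    if "x \<in> S" "z \<in> S" for x z v
  proof -
    have "?D x v - ?D z v = (\<Sum>b\<in>Basis. (v \<bullet> b) *\<^sub>R (?D x b - ?D z b))"
      unfolding frechet_derivative_basis_sum[OF assms(1), of x v]
        frechet_derivative_basis_sum[OF assms(1), of z v]
      by (simp add: sum_subtractf scaleR_diff_right)
    also have "norm \<dots> \<le> (\<Sum>b\<in>(Basis::'a set). norm v * (C * norm (z - x)))"
      by (intro sum_norm_le)
        (auto intro!: mult_mono that Basis_le_norm C'[OF _ that(2) that(1), unfolded norm_minus_commute[of x z]])
    finally show ?thesis by (simp add: mult_ac)
  qed
  have "norm (g z - g x - ?D z (z - x)) \<le> real DIM('a) * C * norm (z - x) ^ 2"
    if xz: "x \<in> S" "z \<in> S" for x z
  proof -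
    have seg: "closed_segment x z \<subseteq> S" using xz assms(3) by (simp add: closed_segment_subset)
    have lin: "bounded_linear (?D z)" for z
      using C_inf_has_derivative[OF assms(1)] has_derivative_bounded_linear by blast
    have "norm ((g z - ?D z z) - (g x - ?D z x)) \<le> (real DIM('a) * C * norm (z - x)) * norm (z - x)"
    proof (rule differentiable_bound[of "closed_segment x z" _ "\<lambda>p v. ?D p v - ?D z v"])
      fix p assume p: "p \<in> closed_segment x z"
      show "((\<lambda>p. g p - ?D z p) has_derivative (\<lambda>v. ?D p v - ?D z v)) (at p within closed_segment x z)"
        by (intro has_derivative_diff has_derivative_at_withinI[OF C_inf_has_derivative[OF assms(1)]]
            bounded_linear_imp_has_derivative lin)
      show "onorm (\<lambda>v. ?D p v - ?D z v) \<le> real DIM('a) * C * norm (z - x)"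
      proof (rule onorm_bound)
        fix v :: 'a
        have "norm (z - p) \<le> norm (z - x)"
          using segment_bound1[of p z x] p by (simp add: closed_segment_commute norm_minus_commute)
        then have "real DIM('a) * C * norm (z - p) * norm v \<le> real DIM('a) * C * norm (z - x) * norm v"
          by (intro mult_right_mono mult_left_mono) (auto simp: C(1))
        then show "norm (?D p v - ?D z v) \<le> real DIM('a) * C * norm (z - x) * norm v"
          using order_trans[OF D[OF subsetD[OF seg p] xz(2)]] by blast
      qed (simp add: C(1))
    qed auto
    moreover have "(g z - ?D z z) - (g x - ?D z x) = g z - g x - ?D z (z - x)"
      by (simp add: linear_diff[OF bounded_linear.linear[OF lin]])
    ultimately show ?thesis by (simp add: power2_eq_square mult_ac)
  qed
  then show ?thesis using C(1) by (intro exI[of _ "real DIM('a) * C"]) auto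
qed

text \<open>Taylor expansion at the right end of a step, for the rescaled equation \<open>z' = h F(z)\<close> on the unit
interval. By induction, the difference of the two sides vanishes at \<open>c = 1\<close> and its derivative is
\<open>h\<close> times the same difference of one order less for \<open>lie F g\<close>. The right end is chosen because the
powers of \<open>1 - c\<close> are the ones that integration by parts produces below.\<close>
lemma flow_taylor_uniform:
  fixes g :: "'a::euclidean_space \<Rightarrow> 'b::euclidean_space"
  assumes "C_inf F" "compact S" "C_inf g"
  shows "\<exists>C\<ge>0. \<forall>h z. 0 \<le> h \<and> z ` {0..1} \<subseteq> S \<and>
      (\<forall>c\<in>{0..1}. (z has_vector_derivative h *\<^sub>R F (z c)) (at c within {0..1})) \<longrightarrow>
      (\<forall>c\<in>{0..1}. norm (g (z c) - (\<Sum>j<s. ((h * (c - 1)) ^ j / fact j) *\<^sub>R (lie F ^^ j) g (z 1)))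
        \<le> C * h ^ s)"
  using assms(3)
proof (induction s arbitrary: g)
  case 0
  then show ?case using C_inf_bounded_on_compact[OF 0 assms(2)] by fastforce
next
  case (Suc s)
  obtain C where C: "C \<ge> 0" "\<And>h z c. 0 \<le> h \<Longrightarrow> z ` {0..1} \<subseteq> S \<Longrightarrow>
      (\<forall>c\<in>{0..1}. (z has_vector_derivative h *\<^sub>R F (z c)) (at c within {0..1})) \<Longrightarrow> c\<in>{0..1} \<Longrightarrow>
      norm (lie F g (z c) - (\<Sum>j<s. ((h * (c - 1)) ^ j / fact j) *\<^sub>R (lie F ^^ j) (lie F g) (z 1))) \<le> C * h ^ s"
    using Suc.IH[OF C_inf_lie[OF assms(1) Suc.prems]] by blast
  have "norm (g (z c) - (\<Sum>j<Suc s. ((h * (c - 1)) ^ j / fact j) *\<^sub>R (lie F ^^ j) g (z 1))) \<le> C * h ^ Suc s"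
    if h: "0 \<le> h" and zS: "z ` {0..1} \<subseteq> S" and c: "c \<in> {0..1}"
      and z: "\<forall>c\<in>{0..1}. (z has_vector_derivative h *\<^sub>R F (z c)) (at c within {0..1})"
    for h z and c :: real
  proof -
    define G where "G j = (lie F ^^ j) g (z 1)" for j
    define p where "p x = g (z x) - (\<Sum>j<Suc s. ((h * (x - 1)) ^ j / fact j) *\<^sub>R G j)" for x
    define p' where "p' x = h *\<^sub>R (lie F g (z x) - (\<Sum>j<s. ((h * (x - 1)) ^ j / fact j) *\<^sub>R G (Suc j)))" for x
    have lin: "bounded_linear (frechet_derivative g (at x))" for x
      using C_inf_has_derivative[OF Suc.prems] has_derivative_bounded_linear by blast
    have dg: "((\<lambda>x. g (z x)) has_vector_derivative h *\<^sub>R lie F g (z x)) (at x within {0..1})"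
      if x: "x \<in> {0..1}" for x
    proof -
      have "((\<lambda>x. g (z x)) has_derivative (\<lambda>t. frechet_derivative g (at (z x)) (t *\<^sub>R h *\<^sub>R F (z x)))) (at x within {0..1})"
        using z x unfolding has_vector_derivative_def
        by (intro has_derivative_compose[OF _ C_inf_has_derivative[OF Suc.prems]]) auto
      then show ?thesis
        unfolding has_vector_derivative_def lie_def
        by (simp add: linear_scale[OF bounded_linear.linear[OF lin]])
    qed
    have dpoly: "((\<lambda>x. \<Sum>j<Suc s. ((h * (x - 1)) ^ j / fact j) *\<^sub>R G j) has_vector_derivative
          h *\<^sub>R (\<Sum>j<s. ((h * (x - 1)) ^ j / fact j) *\<^sub>R G (Suc j))) (at x within {0..1})" for x
    proof -
      have "((\<lambda>x. (h * (x - 1)) ^ Suc j / fact (Suc j)) has_real_derivative h * ((h * (x - 1)) ^ j / fact j))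
           (at x within {0..1})" for j
      proof -
        have "((\<lambda>x. h * (x - 1)) has_real_derivative h) (at x within {0..1})"
          by (auto intro!: derivative_eq_intros)
        from DERIV_cdivide[OF DERIV_power[OF this, of "Suc j"], of "fact (Suc j)"]
        have "((\<lambda>x. (h * (x - 1)) ^ Suc j / fact (Suc j)) has_real_derivative
            real (Suc j) * (h * (h * (x - 1)) ^ j) / (real (Suc j) * fact j)) (at x within {0..1})"
          by (simp only: fact_Suc diff_Suc_1 diff_Suc_Suc diff_zero of_nat_mult One_nat_def)
        then show ?thesis by (simp only: mult_divide_mult_cancel_left_if) simp
      qed
      then have "((\<lambda>x. ((h * (x - 1)) ^ Suc j / fact (Suc j)) *\<^sub>R G (Suc j)) has_vector_derivative
           (h * ((h * (x - 1)) ^ j / fact j)) *\<^sub>R G (Suc j)) (at x within {0..1})" for j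
        using has_vector_derivative_scaleR[of "\<lambda>x. (h * (x - 1)) ^ Suc j / fact (Suc j)", OF _ has_vector_derivative_const]
        by fastforce
      then have "((\<lambda>x. G 0 + (\<Sum>j<s. ((h * (x - 1)) ^ Suc j / fact (Suc j)) *\<^sub>R G (Suc j))) has_vector_derivative
          0 + (\<Sum>j<s. (h * ((h * (x - 1)) ^ j / fact j)) *\<^sub>R G (Suc j))) (at x within {0..1})"
        by (intro has_vector_derivative_add has_vector_derivative_sum has_vector_derivative_const)
      then show ?thesis
        by (subst sum.lessThan_Suc_shift) (simp add: scaleR_sum_right)
    qed
    have p: "(p has_vector_derivative p' x) (at x within {0..1})" if "x \<in> {0..1}" for x
      unfolding p_def p'_def scaleR_diff_right by (intro has_vector_derivative_diff dg dpoly that)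
    have "norm (p' x) \<le> C * h ^ Suc s" if "x \<in> {0..1}" for x
    proof -
      have "h * norm (lie F g (z x) - (\<Sum>j<s. ((h * (x - 1)) ^ j / fact j) *\<^sub>R G (Suc j))) \<le> h * (C * h ^ s)"
        using C(2)[OF h zS z that] unfolding G_def funpow_Suc_right o_def
        by (intro mult_left_mono h)
      then show ?thesis using h by (simp add: p'_def mult_ac)
    qed
    then have "norm (p c - p 1) \<le> C * h ^ Suc s * norm (c - 1)"
      using c p h C(1) unfolding has_vector_derivative_def
      by (intro differentiable_bound[of "{0..1}" p "\<lambda>x t. t *\<^sub>R p' x"])
        (auto intro!: onorm_bound simp: mult.commute[of "\<bar>_\<bar>"] mult_right_mono)
    also have "\<dots> \<le> C * h ^ Suc s * 1"
      using c h C(1) by (intro mult_left_mono) auto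
    finally have "norm (p c - p 1) \<le> C * h ^ Suc s" by simp
    moreover have "p 1 = 0"
      unfolding p_def by (subst sum.lessThan_Suc_shift) (simp add: G_def)
    ultimately show ?thesis unfolding p_def G_def by simp
  qed
  then show ?case using C(1) by blast
qed

section \<open>Superconvergence for a perturbed linear step\<close>

definition moment :: "nat \<Rightarrow> (real \<Rightarrow> 'a::euclidean_space) \<Rightarrow> 'a" where
  "moment i g = integral {0..1} (\<lambda>c. (1 - c) ^ i *\<^sub>R g c)"

lemma norm_moment_le:
  fixes g :: "real \<Rightarrow> 'a::euclidean_space"
  assumes "continuous_on {0..1} g" "\<And>c. c \<in> {0..1} \<Longrightarrow> norm (g c) \<le> B"
  shows "norm (moment i g) \<le> B"
proof -
  have "norm ((1 - c) ^ i *\<^sub>R g c) \<le> B" if c: "c \<in> {0..1}" for c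
  proof -
    have "\<bar>1 - c\<bar> ^ i * norm (g c) \<le> 1 * norm (g c)"
      using c by (intro mult_right_mono power_le_one) auto
    then show ?thesis using assms(2)[OF c] by (simp add: power_abs)
  qed
  then have "norm (moment i g) \<le> B * (1 - 0)"
    unfolding moment_def using assms(1)
    by (intro integral_bound) (auto intro!: continuous_intros)
  then show ?thesis by simp
qed

lemma moment_add:
  fixes f g :: "real \<Rightarrow> 'a::euclidean_space"
  assumes "continuous_on {0..1} f" "continuous_on {0..1} g"
  shows "moment i (\<lambda>c. f c + g c) = moment i f + moment i g"
  unfolding moment_def scaleR_add_right
  by (intro integral_add integrable_continuous_real continuous_intros assms)

lemma moment_scaleR: "moment i (\<lambda>c. a *\<^sub>R g c) = a *\<^sub>R moment i g"
  unfolding moment_def by (simp only: integral_cmul[symmetric] scaleR_scaleR mult.commute)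

text \<open>The error equation of one step. Here \<open>e\<close> is the error, \<open>r\<close> the defect of the numerical
solution and \<open>d\<close> the difference of the two right-hand sides, which is linear in \<open>e\<close> up to a remainder
of order \<open>D + h ^ (2 * s)\<close>; the coefficient of the linear part is a polynomial in \<open>h * (1 - c)\<close>. The number
\<open>D\<close> collects the errors inherited from earlier steps.\<close>
definition perturbed_step :: "real \<Rightarrow> nat \<Rightarrow> real \<Rightarrow> real \<Rightarrow> (nat \<Rightarrow> 'a::euclidean_space \<Rightarrow> 'a)
    \<Rightarrow> (real \<Rightarrow> 'a) \<Rightarrow> (real \<Rightarrow> 'a) \<Rightarrow> (real \<Rightarrow> 'a) \<Rightarrow> bool" where
  "perturbed_step M s h D A e d r \<longleftrightarrow>
     0 < h \<and> h \<le> 1 \<and> norm (e 0) \<le> D \<and>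
     (\<forall>j<s. bounded_linear (A j) \<and> (\<forall>v. norm (A j v) \<le> M * norm v)) \<and>
     continuous_on {0..1} d \<and> continuous_on {0..1} r \<and>
     (\<forall>c\<in>{0..1}. (e has_vector_derivative h *\<^sub>R (d c + r c)) (at c within {0..1})) \<and>
     (\<forall>c\<in>{0..1}. norm (e c) \<le> M * (D + h ^ s) \<and> norm (r c) \<le> M * (D + h ^ s) \<and>
        norm (d c - (\<Sum>j<s. (h * (1 - c)) ^ j *\<^sub>R A j (e c))) \<le> M * (D + h ^ (2 * s))) \<and>
     (\<forall>i<s. moment i r = 0)"

text \<open>The antiderivative of \<open>(1 - c) ^ i\<close> that vanishes at the right end is used, so that only the
initial value of \<open>e\<close> remains and the exponent increases by one.\<close>
lemma moment_by_parts:
  fixes e g :: "real \<Rightarrow> 'a::euclidean_space"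
  assumes "\<And>c. c \<in> {0..1} \<Longrightarrow> (e has_vector_derivative g c) (at c within {0..1})"
    and "continuous_on {0..1} g"
  shows "moment i e = (1 / real (Suc i)) *\<^sub>R (e 0 + moment (Suc i) g)"
proof -
  have ce: "continuous_on {0..1} e"
    using assms(1) by (meson continuous_on_eq_continuous_within has_vector_derivative_continuous)
  have "((\<lambda>c. (1 - c) ^ Suc i *\<^sub>R e c) has_vector_derivative
      (1 - c) ^ Suc i *\<^sub>R g c + (- (real (Suc i) * (1 - c) ^ i)) *\<^sub>R e c) (at c within {0..1})"
    if c: "c \<in> {0..1}" for c :: real
  proof (rule has_vector_derivative_scaleR[OF _ assms(1)[OF c]])
    have "((\<lambda>c. 1 - c) has_real_derivative -1) (at c within {0..1})"
      by (auto intro!: derivative_eq_intros)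
    from DERIV_power[OF this, of "Suc i"]
    show "((\<lambda>c. (1 - c) ^ Suc i) has_real_derivative - (real (Suc i) * (1 - c) ^ i)) (at c within {0..1})"
      by simp
  qed
  then have "((\<lambda>c. (1 - c) ^ Suc i *\<^sub>R g c + (- (real (Suc i) * (1 - c) ^ i)) *\<^sub>R e c) has_integral
      (1 - 1) ^ Suc i *\<^sub>R e 1 - (1 - 0) ^ Suc i *\<^sub>R e 0) {0..1}"
    by (intro fundamental_theorem_of_calculus) auto
  then have "integral {0..1} (\<lambda>c. (1 - c) ^ Suc i *\<^sub>R g c + (- real (Suc i)) *\<^sub>R ((1 - c) ^ i *\<^sub>R e c)) = - e 0"
    unfolding scaleR_scaleR mult_minus_left by (intro integral_unique) simp
  moreover have "integral {0..1} (\<lambda>c. (1 - c) ^ Suc i *\<^sub>R g c + (- real (Suc i)) *\<^sub>R ((1 - c) ^ i *\<^sub>R e c))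
      = moment (Suc i) g + (- real (Suc i)) *\<^sub>R moment i e"
    unfolding moment_def integral_cmul[symmetric]
    by (intro integral_add integrable_continuous_real continuous_intros assms(2) ce)
  ultimately have "moment (Suc i) g - real (Suc i) *\<^sub>R moment i e = - e 0"
    by (metis add_uminus_conv_diff scaleR_minus_left)
  then have "real (Suc i) *\<^sub>R moment i e = e 0 + moment (Suc i) g" by (simp add: algebra_simps)
  then show ?thesis by (metis divide_inverse mult_1 of_nat_neq_0 scaleR_one scaleR_scaleR left_inverse)
qed

text \<open>A factor \<open>(h * (1 - c)) ^ j\<close> of the linear part raises the index of the moment of \<open>e\<close> and supplies the matching
power of \<open>h\<close>. The scaled moments \<open>h ^ k *\<^sub>R moment k e\<close> are therefore the quantities that
close up.\<close>
lemma forcing_moment_le: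
  assumes "perturbed_step M s h D A e d r"
  shows "norm (h ^ k *\<^sub>R moment k d) \<le> M * (D + h ^ (2 * s)) + (\<Sum>j<s. M * norm (h ^ (k + j) *\<^sub>R moment (k + j) e))"
proof -
  let ?L = "\<lambda>c. \<Sum>j<s. (h * (1 - c)) ^ j *\<^sub>R A j (e c)"
  note ps = assms[unfolded perturbed_step_def]
  have h: "0 < h" "h \<le> 1" and lin: "\<And>j. j < s \<Longrightarrow> bounded_linear (A j)"
    and A: "\<And>j v. j < s \<Longrightarrow> norm (A j v) \<le> M * norm v"
    and cd: "continuous_on {0..1} d"
    and q: "\<And>c. c \<in> {0..1} \<Longrightarrow> norm (d c - ?L c) \<le> M * (D + h ^ (2 * s))"
    using ps by auto
  have ce: "continuous_on {0..1} e"
    using ps by (meson continuous_on_eq_continuous_within has_vector_derivative_continuous)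
  have cA: "continuous_on {0..1} (\<lambda>c. A j (e c))" if "j < s" for j
    by (rule bounded_linear.continuous_on[OF lin[OF that] ce])
  have cL: "continuous_on {0..1} ?L"
    by (intro continuous_intros cA) auto
  have "moment k d = moment k (\<lambda>c. d c - ?L c) + moment k ?L"
    by (subst moment_add[symmetric]) (auto intro!: continuous_on_diff cd cL)
  also have "moment k ?L = (\<Sum>j<s. h ^ j *\<^sub>R A j (moment (k + j) e))"
  proof -
    have "moment k ?L = integral {0..1} (\<lambda>c. \<Sum>j<s. h ^ j *\<^sub>R A j ((1 - c) ^ (k + j) *\<^sub>R e c))"
      unfolding moment_def
      by (intro integral_cong)
        (simp add: scaleR_sum_right linear_scale[OF bounded_linear.linear[OF lin]] power_mult_distrib power_add mult_ac)
    also have "\<dots> = (\<Sum>j<s. integral {0..1} (\<lambda>c. h ^ j *\<^sub>R A j ((1 - c) ^ (k + j) *\<^sub>R e c)))"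
      by (intro integral_sum integrable_continuous_real continuous_intros bounded_linear.continuous_on[OF lin] ce) auto
    also have "\<dots> = (\<Sum>j<s. h ^ j *\<^sub>R A j (moment (k + j) e))"
    proof (intro sum.cong refl)
      fix j assume "j \<in> {..<s}"
      then have "integral {0..1} (A j \<circ> (\<lambda>c. (1 - c) ^ (k + j) *\<^sub>R e c)) = A j (moment (k + j) e)"
        unfolding moment_def
        by (intro integral_linear integrable_continuous_real continuous_intros ce lin) auto
      then show "integral {0..1} (\<lambda>c. h ^ j *\<^sub>R A j ((1 - c) ^ (k + j) *\<^sub>R e c)) = h ^ j *\<^sub>R A j (moment (k + j) e)"
        by (simp add: o_def)
    qed
    finally show ?thesis .
  qed
  finally have eq: "h ^ k *\<^sub>R moment k d
      = h ^ k *\<^sub>R moment k (\<lambda>c. d c - ?L c) + (\<Sum>j<s. h ^ (k + j) *\<^sub>R A j (moment (k + j) e))"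
    by (simp add: scaleR_add_right scaleR_sum_right power_add)
  have "norm (h ^ k *\<^sub>R moment k (\<lambda>c. d c - ?L c)) \<le> 1 * norm (moment k (\<lambda>c. d c - ?L c))"
    using h by (simp add: mult_left_le_one_le power_le_one)
  also have "\<dots> \<le> M * (D + h ^ (2 * s))"
    using norm_moment_le[OF _ q, where i = k] by (simp add: continuous_on_diff cd cL)
  finally have 1: "norm (h ^ k *\<^sub>R moment k (\<lambda>c. d c - ?L c)) \<le> M * (D + h ^ (2 * s))" .
  have 2: "norm (\<Sum>j<s. h ^ (k + j) *\<^sub>R A j (moment (k + j) e)) \<le> (\<Sum>j<s. M * norm (h ^ (k + j) *\<^sub>R moment (k + j) e))"
  proof (intro sum_norm_le)
    fix j assume "j \<in> {..<s}"
    then have "h ^ (k + j) * norm (A j (moment (k + j) e)) \<le> h ^ (k + j) * (M * norm (moment (k + j) e))"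
      using h by (intro mult_left_mono A) auto
    then show "norm (h ^ (k + j) *\<^sub>R A j (moment (k + j) e)) \<le> M * norm (h ^ (k + j) *\<^sub>R moment (k + j) e)"
      using h by (simp add: mult_ac)
  qed
  show ?thesis unfolding eq using norm_triangle_le[OF add_mono[OF 1 2]] .
qed

text \<open>This is the source of superconvergence. For an index of at least \<open>s\<close> the factor \<open>h ^ s\<close> meets the a priori bound
of order \<open>D + h ^ s\<close> for \<open>e\<close>. Integration by parts expresses the moment of index \<open>n\<close> through the
initial value, moments of index above \<open>n\<close> and a moment of the defect of index \<open>n + 1\<close>, which vanishes for \<open>n + 1 < s\<close> and
is of order \<open>D + h ^ s\<close> for \<open>n + 1 = s\<close>; so a downward induction applies. It plays the role of the
adjoint equation in the classical argument by variation of constants.\<close>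
lemma weighted_moment_bound:
  assumes "0 \<le> M"
  shows "\<exists>C\<ge>0. \<forall>k h D (A :: nat \<Rightarrow> 'a::euclidean_space \<Rightarrow> 'a) e d r. perturbed_step M s h D A e d r \<longrightarrow>
      norm (h ^ k *\<^sub>R moment k e) \<le> C * (D + h ^ (2 * s))"
proof -
  have "\<exists>C\<ge>0. \<forall>k\<ge>n. \<forall>h D (A :: nat \<Rightarrow> 'a \<Rightarrow> 'a) e d r. perturbed_step M s h D A e d r \<longrightarrow>
      norm (h ^ k *\<^sub>R moment k e) \<le> C * (D + h ^ (2 * s))" if "n \<le> s" for n
    using that
  proof (induction n rule: inc_induct)
    case base
    have "norm (h ^ k *\<^sub>R moment k e) \<le> M * (D + h ^ (2 * s))"
      if "s \<le> k" and ps: "perturbed_step M s h D A e d r" for k h D and A :: "nat \<Rightarrow> 'a \<Rightarrow> 'a" and e d r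
    proof -
      note ps = ps[unfolded perturbed_step_def]
      have h: "0 < h" "h \<le> 1" and D: "0 \<le> D" using ps order_trans[OF norm_ge_zero, of "e 0" D] by auto
      have ce: "continuous_on {0..1} e"
        using ps by (meson continuous_on_eq_continuous_within has_vector_derivative_continuous)
      have "norm (moment k e) \<le> M * (D + h ^ s)" using ps by (intro norm_moment_le ce) auto
      moreover have "h ^ k \<le> h ^ s" using h \<open>s \<le> k\<close> by (simp add: power_decreasing)
      ultimately have "h ^ k * norm (moment k e) \<le> h ^ s * (M * (D + h ^ s))"
        using h by (intro mult_mono) auto
      also have "\<dots> = M * (h ^ s * D + h ^ (2 * s))" 
        by (simp add: mult_2 power_add distrib_left mult.left_commute[of "h ^ s" M])
      also have "\<dots> \<le> M * (D + h ^ (2 * s))"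
        using h D assms by (intro mult_left_mono add_mono) (auto simp: mult_left_le_one_le power_le_one)
      finally show ?thesis using h by simp
    qed
    then show ?case using assms by blast
  next
    case (step n)
    then obtain C where C: "C \<ge> 0" "\<And>k h D (A :: nat \<Rightarrow> 'a \<Rightarrow> 'a) e d r. Suc n \<le> k \<Longrightarrow>
        perturbed_step M s h D A e d r \<Longrightarrow> norm (h ^ k *\<^sub>R moment k e) \<le> C * (D + h ^ (2 * s))"
      by blast
    let ?C = "C + (1 + M + real s * M * C + M)"
    have "norm (h ^ k *\<^sub>R moment k e) \<le> ?C * (D + h ^ (2 * s))"
      if "n \<le> k" and ps: "perturbed_step M s h D A e d r" for k h D and A :: "nat \<Rightarrow> 'a \<Rightarrow> 'a" and e d r
    proof -
      note ps' = ps[unfolded perturbed_step_def]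
      have h: "0 < h" "h \<le> 1" and D: "0 \<le> D" using ps' order_trans[OF norm_ge_zero, of "e 0" D] by auto
      have c: "continuous_on {0..1} d" "continuous_on {0..1} r" using ps' by auto
      define X where "X = D + h ^ (2 * s)"
      have X: "0 \<le> X" "D \<le> X" using D h by (auto simp: X_def)
      show ?thesis
      proof (cases "Suc n \<le> k")
        case True
        then have "norm (h ^ k *\<^sub>R moment k e) \<le> C * X" unfolding X_def using C(2) ps by blast
        also have "\<dots> \<le> ?C * X" using X assms C(1) by (intro mult_right_mono) auto
        finally show ?thesis unfolding X_def .
      next
        case False
        then have k: "k = n" using \<open>n \<le> k\<close> by simp
        have "moment n e = (1 / real (Suc n)) *\<^sub>R (e 0 + moment (Suc n) (\<lambda>c. h *\<^sub>R (d c + r c)))"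
          using ps' by (intro moment_by_parts) (auto intro!: continuous_intros)
        also have "moment (Suc n) (\<lambda>c. h *\<^sub>R (d c + r c)) = h *\<^sub>R (moment (Suc n) d + moment (Suc n) r)"
          unfolding moment_add[OF c, symmetric] by (rule moment_scaleR)
        finally have eq: "h ^ n *\<^sub>R moment n e = (1 / real (Suc n)) *\<^sub>R
            (h ^ n *\<^sub>R e 0 + (h ^ Suc n *\<^sub>R moment (Suc n) d + h ^ Suc n *\<^sub>R moment (Suc n) r))"
          by (simp add: scaleR_add_right mult_ac)
        have b0: "norm (h ^ n *\<^sub>R e 0) \<le> X"
        proof -
          have "h ^ n * norm (e 0) \<le> 1 * norm (e 0)" using h by (intro mult_right_mono power_le_one) auto
          then show ?thesis using ps' h X by auto
        qed
        have bd: "norm (h ^ Suc n *\<^sub>R moment (Suc n) d) \<le> M * X + real s * M * C * X"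
        proof -
          have "norm (h ^ Suc n *\<^sub>R moment (Suc n) d) \<le>
              M * X + (\<Sum>j<s. M * norm (h ^ (Suc n + j) *\<^sub>R moment (Suc n + j) e))"
            unfolding X_def by (rule forcing_moment_le[OF ps])
          also have "\<dots> \<le> M * X + (\<Sum>j<s. M * (C * X))"
            unfolding X_def by (intro add_mono sum_mono mult_left_mono order_refl C(2)[OF _ ps] assms) simp
          finally show ?thesis by (simp add: mult_ac)
        qed
        \<comment> \<open>By orthogonality only the index \<open>s\<close> can contribute, and there the scaling factor is already \<open>h ^ s\<close>.\<close>
        have br: "norm (h ^ Suc n *\<^sub>R moment (Suc n) r) \<le> M * X"
        proof (cases "Suc n < s")
          case True
          then have "moment (Suc n) r = 0" using ps' by auto
          then show ?thesis using assms X by simp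
        next
          case False
          then have sn: "Suc n = s" using step.hyps by simp
          have "norm (moment s r) \<le> M * (D + h ^ s)" using ps' by (intro norm_moment_le) auto
          then have "h ^ s * norm (moment s r) \<le> h ^ s * (M * (D + h ^ s))" using h by (intro mult_left_mono) auto
          also have "\<dots> = M * (h ^ s * D + h ^ (2 * s))" 
        by (simp add: mult_2 power_add distrib_left mult.left_commute[of "h ^ s" M])
          also have "\<dots> \<le> M * X" unfolding X_def
            using h D assms by (intro mult_left_mono add_mono) (auto simp: mult_left_le_one_le power_le_one)
          finally show ?thesis using h unfolding sn by simp
        qed
        have "norm (h ^ n *\<^sub>R e 0 + (h ^ Suc n *\<^sub>R moment (Suc n) d + h ^ Suc n *\<^sub>R moment (Suc n) r))
            \<le> X + ((M * X + real s * M * C * X) + M * X)"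
          by (intro norm_triangle_le add_mono b0 bd br)
        moreover have "norm (h ^ n *\<^sub>R moment n e) \<le>
            1 * norm (h ^ n *\<^sub>R e 0 + (h ^ Suc n *\<^sub>R moment (Suc n) d + h ^ Suc n *\<^sub>R moment (Suc n) r))"
          unfolding eq norm_scaleR by (intro mult_right_mono) auto
        ultimately have "norm (h ^ n *\<^sub>R moment n e) \<le> 0 * X + (1 + M + real s * M * C + M) * X"
          by (simp add: algebra_simps)
        also have "\<dots> \<le> C * X + (1 + M + real s * M * C + M) * X"
          using C(1) X by (intro add_right_mono mult_right_mono) auto
        finally show ?thesis unfolding k X_def by (simp add: distrib_right)
      qed
    qed
    moreover have "0 \<le> ?C" using C(1) assms by auto
    ultimately show ?case by blast
  qed
  from this[of 0] show ?thesis by simp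
qed

text \<open>The increment is the integral of \<open>h *\<^sub>R (d + r)\<close>. The defect has mean zero since \<open>s > 0\<close>, and the mean of
\<open>d\<close> is a combination of the scaled moments of \<open>e\<close>.\<close>
lemma perturbed_step_increment:
  assumes "0 \<le> M" "0 < s"
  shows "\<exists>C\<ge>0. \<forall>h D (A :: nat \<Rightarrow> 'a::euclidean_space \<Rightarrow> 'a) e d r. perturbed_step M s h D A e d r \<longrightarrow>
      norm (e 1 - e 0) \<le> C * h * (D + h ^ (2 * s))"
proof -
  obtain C where C: "C \<ge> 0" "\<And>k h D (A :: nat \<Rightarrow> 'a \<Rightarrow> 'a) e d r.
      perturbed_step M s h D A e d r \<Longrightarrow> norm (h ^ k *\<^sub>R moment k e) \<le> C * (D + h ^ (2 * s))"
    using weighted_moment_bound[OF assms(1)] by blast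
  have "norm (e 1 - e 0) \<le> (M + real s * M * C) * h * (D + h ^ (2 * s))"
    if ps: "perturbed_step M s h D A e d r" for h D and A :: "nat \<Rightarrow> 'a \<Rightarrow> 'a" and e d r
  proof -
    note ps' = ps[unfolded perturbed_step_def]
    have h: "0 < h" and c: "continuous_on {0..1} d" "continuous_on {0..1} r" using ps' by auto
    have "((\<lambda>c. h *\<^sub>R (d c + r c)) has_integral e 1 - e 0) {0..1}"
      using ps' by (intro fundamental_theorem_of_calculus) auto
    from integral_unique[OF this] have "e 1 - e 0 = h *\<^sub>R integral {0..1} (\<lambda>c. d c + r c)"
      by (simp only: integral_cmul)
    also have "integral {0..1} (\<lambda>c. d c + r c) = moment 0 d + moment 0 r"
      unfolding moment_add[OF c, symmetric] by (simp add: moment_def)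
    finally have "e 1 - e 0 = h *\<^sub>R (h ^ 0 *\<^sub>R moment 0 d)" using ps' assms(2) by simp
    then have "norm (e 1 - e 0) = h * norm (h ^ 0 *\<^sub>R moment 0 d)" using h by simp
    also have "\<dots> \<le> h * (M * (D + h ^ (2 * s)) + (\<Sum>j<s. M * norm (h ^ (0 + j) *\<^sub>R moment (0 + j) e)))"
      using h by (intro mult_left_mono forcing_moment_le[OF ps]) auto
    also have "\<dots> \<le> h * (M * (D + h ^ (2 * s)) + (\<Sum>j<s. M * (C * (D + h ^ (2 * s)))))"
      using h assms(1) C(2)[OF ps] by (intro mult_left_mono add_mono sum_mono) auto
    finally show ?thesis by (simp add: algebra_simps)
  qed
  moreover have "0 \<le> M + real s * M * C" using assms(1) C(1) by auto
  ultimately show ?thesis by blast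
qed

section \<open>Projection onto polynomials\<close>

text \<open>The \<open>L\<^sup>2\<close>-orthogonal projection onto polynomials of degree less than \<open>s\<close>. The derivative of
the piecewise polynomial approximation is this projection of its right-hand side.\<close>
definition legendre_proj :: "(nat \<Rightarrow> real poly) \<Rightarrow> nat \<Rightarrow> (real \<Rightarrow> 'a::euclidean_space) \<Rightarrow> real \<Rightarrow> 'a" where
  "legendre_proj P s g c = (\<Sum>j<s. poly (P j) c *\<^sub>R integral {0..1} (\<lambda>x. poly (P j) x *\<^sub>R g x))"

lemma continuous_on_legendre_proj [continuous_intros]: "continuous_on S (legendre_proj P s g)"
  unfolding legendre_proj_def by (intro continuous_intros)

text \<open>Subtracting a multiple of \<open>P s\<close> removes the leading coefficient.\<close>
lemma legendre_span:
  assumes "orthonormal_legendre P" "degree p < s"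
  shows "\<exists>a. p = (\<Sum>j<s. smult (a j) (P j))"
  using assms(2)
proof (induction s arbitrary: p)
  case (Suc s)
  have deg: "degree (P j) = j" for j using assms(1) by (simp add: orthonormal_legendre_def)
  have "integral {0..1} (\<lambda>x. poly (P s) x * poly (P s) x) = 1"
    using assms(1) by (simp add: orthonormal_legendre_def)
  then have "P s \<noteq> 0" by auto
  then have lc: "coeff (P s) s \<noteq> 0" using deg[of s] by (metis leading_coeff_0_iff)
  define b where "b = coeff p s / coeff (P s) s"
  define q where "q = p - smult b (P s)"
  show ?case
  proof (cases "s = 0")
    case True
    then have "degree q \<le> 0" unfolding q_def using Suc.prems deg[of 0] by (intro degree_diff_le) auto
    moreover have "coeff q 0 = 0" using lc True by (simp add: q_def b_def)
    ultimately have "q = 0" by (metis leading_coeff_0_iff le_zero_eq)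
    then show ?thesis using True by (intro exI[of _ "\<lambda>_. b"]) (simp add: q_def)
  next
    case False
    have "degree q < s"
    proof (rule degree_lessI)
      show "q \<noteq> 0 \<or> s > 0" using False by simp
      show "\<forall>k\<ge>s. coeff q k = 0"
      proof (intro allI impI)
        fix k assume "s \<le> k"
        then show "coeff q k = 0"
          using lc Suc.prems deg[of s] by (cases "k = s") (auto simp: q_def b_def coeff_eq_0)
      qed
    qed
    then obtain a where "q = (\<Sum>j<s. smult (a j) (P j))" using Suc.IH by blast
    then have "p = (\<Sum>j<s. smult (a j) (P j)) + smult b (P s)" by (simp add: q_def algebra_simps)
    then show ?thesis by (intro exI[of _ "a(s := b)"]) simp
  qed
qed simp

lemma legendre_proj_poly:
  assumes "orthonormal_legendre P" "degree p < s" "c \<in> {0..1}"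
  shows "legendre_proj P s (\<lambda>x. poly p x *\<^sub>R v) c = poly p c *\<^sub>R v"
proof -
  obtain a where a: "p = (\<Sum>j<s. smult (a j) (P j))" using legendre_span assms by blast
  have orth: "integral {0..1} (\<lambda>x. poly (P i) x * poly (P j) x) = (if i = j then 1 else 0)" for i j
    using assms(1) by (simp add: orthonormal_legendre_def)
  have "integral {0..1} (\<lambda>x. poly (P j) x *\<^sub>R poly p x *\<^sub>R v) = a j *\<^sub>R v" if "j < s" for j
  proof -
    have "integral {0..1} (\<lambda>x. poly (P j) x * poly p x) = integral {0..1} (\<lambda>x. \<Sum>i<s. a i * (poly (P j) x * poly (P i) x))"
      by (simp add: a poly_sum sum_distrib_left mult_ac)
    also have "\<dots> = (\<Sum>i<s. integral {0..1} (\<lambda>x. a i * (poly (P j) x * poly (P i) x)))"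
      by (intro integral_sum integrable_continuous_real continuous_intros) auto
    also have "\<dots> = (\<Sum>i<s. a i * (if j = i then 1 else 0))"
      by (simp only: integral_mult_right orth)
    also have "\<dots> = (\<Sum>i<s. if j = i then a i else 0)" by (intro sum.cong) auto
    also have "\<dots> = a j" using that by simp
    finally have "integral {0..1} (\<lambda>x. poly (P j) x * poly p x) = a j" .
    moreover have "(\<lambda>x. poly (P j) x * poly p x) integrable_on {0..1}"
      by (intro integrable_continuous_real continuous_intros)
    ultimately have "((\<lambda>x. poly (P j) x * poly p x) has_integral a j) {0..1}"
      using integrable_integral by fastforce
    from has_integral_scaleR_left[OF this, of v] show ?thesis
      by (intro integral_unique) simp
  qed
  then show ?thesis
    by (simp add: legendre_proj_def a poly_sum scaleR_sum_left mult_ac)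
qed

lemma legendre_proj_diff:
  assumes "continuous_on {0..1} f" "continuous_on {0..1} g"
  shows "legendre_proj P s (\<lambda>x. f x - g x) c = legendre_proj P s f c - legendre_proj P s g c"
proof -
  have "integral {0..1} (\<lambda>x. poly (P j) x *\<^sub>R (f x - g x)) =
     integral {0..1} (\<lambda>x. poly (P j) x *\<^sub>R f x) - integral {0..1} (\<lambda>x. poly (P j) x *\<^sub>R g x)" for j
    unfolding scaleR_diff_right
    by (intro integral_diff integrable_continuous_real continuous_intros assms)
  then show ?thesis by (simp add: legendre_proj_def scaleR_diff_right sum_subtractf)
qed

lemma legendre_proj_bound:
  shows "\<exists>C\<ge>0. \<forall>(g :: real \<Rightarrow> 'a::euclidean_space) B. continuous_on {0..1} g \<longrightarrow> (\<forall>x\<in>{0..1}. norm (g x) \<le> B) \<longrightarrow>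
      (\<forall>c\<in>{0..1}. norm (legendre_proj P s g c) \<le> C * B)"
proof -
  have "\<exists>C\<ge>0. \<forall>j\<in>{..<s}. \<forall>c. c \<in> {0..1::real} \<longrightarrow> \<bar>poly (P j) c\<bar> \<le> C"
  proof (rule finite_family_bound)
    fix j
    have "bounded (poly (P j) ` {0..1})"
      by (intro compact_imp_bounded compact_continuous_image continuous_intros) auto
    then obtain C where "\<forall>x\<in>{0..1}. \<bar>poly (P j) x\<bar> \<le> C" by (auto simp: bounded_iff)
    then have "\<forall>x. x \<in> {0..1} \<longrightarrow> \<bar>poly (P j) x\<bar> \<le> max 0 C" by fastforce
    then show "\<exists>C\<ge>0. \<forall>x. x \<in> {0..1} \<longrightarrow> \<bar>poly (P j) x\<bar> \<le> C" by (meson max.cobounded1)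
  qed simp
  then obtain C where C: "C \<ge> 0" "\<And>j c. j < s \<Longrightarrow> c \<in> {0..1} \<Longrightarrow> \<bar>poly (P j) c\<bar> \<le> C" by auto
  have "norm (legendre_proj P s g c) \<le> (real s * (C * C)) * B"
    if g: "continuous_on {0..1} g" "\<forall>x\<in>{0..1}. norm (g x) \<le> B" and c: "c \<in> {0..1}"
    for g :: "real \<Rightarrow> 'a" and B c
  proof -
    have "norm (legendre_proj P s g c) \<le> (\<Sum>j<s. C * (C * B))"
      unfolding legendre_proj_def
    proof (intro sum_norm_le)
      fix j assume j: "j \<in> {..<s}"
      have "norm (poly (P j) x *\<^sub>R g x) \<le> C * B" if "x \<in> {0..1}" for x
        using C(2)[of j x] g(2) that j C(1) by (auto intro!: mult_mono)
      then have "norm (integral {0..1} (\<lambda>x. poly (P j) x *\<^sub>R g x)) \<le> (C * B) * (1 - 0)"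
        by (intro integral_bound) (auto intro!: continuous_intros g)
      then show "norm (poly (P j) c *\<^sub>R integral {0..1} (\<lambda>x. poly (P j) x *\<^sub>R g x)) \<le> C * (C * B)"
        using C j c by (auto intro!: mult_mono)
    qed
    then show ?thesis by (simp add: mult_ac)
  qed
  then show ?thesis using C(1) by (intro exI[of _ "real s * (C * C)"]) auto
qed

lemma moment_legendre_residual:
  fixes g :: "real \<Rightarrow> 'a::euclidean_space"
  assumes "orthonormal_legendre P" "continuous_on {0..1} g" "i < s"
  shows "moment i (\<lambda>c. g c - legendre_proj P s g c) = 0"
proof -
  define \<gamma> where "\<gamma> j = integral {0..1} (\<lambda>x. poly (P j) x *\<^sub>R g x)" for j
  define q where "q = [:1, -1::real:] ^ i"
  have q: "poly q c = (1 - c) ^ i" for c :: real by (simp add: q_def)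
  have "degree q \<le> i" unfolding q_def using degree_power_le[of "[:1, -1::real:]" i] by simp
  then obtain a where a: "q = (\<Sum>j<s. smult (a j) (P j))"
    using legendre_span[OF assms(1), of q s] assms(3) by auto
  have orth: "integral {0..1} (\<lambda>x. poly (P i) x * poly (P j) x) = (if i = j then 1 else 0)" for i j
    using assms(1) by (simp add: orthonormal_legendre_def)
  have P: "integral {0..1} (\<lambda>c. poly (P j) c *\<^sub>R legendre_proj P s g c) = \<gamma> j" if "j < s" for j
  proof -
    have hi: "((\<lambda>c. poly (P j) c * poly (P i) c) has_integral (if j = i then 1 else 0)) {0..1}" for i
      unfolding orth[symmetric] by (intro integrable_integral integrable_continuous_real continuous_intros)
    have "((\<lambda>c. \<Sum>i<s. (poly (P j) c * poly (P i) c) *\<^sub>R \<gamma> i) has_integral (\<Sum>i<s. (if j = i then 1 else 0) *\<^sub>R \<gamma> i)) {0..1}"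
      by (intro has_integral_sum has_integral_scaleR_left hi) auto
    also have "(\<lambda>c. \<Sum>i<s. (poly (P j) c * poly (P i) c) *\<^sub>R \<gamma> i) = (\<lambda>c. poly (P j) c *\<^sub>R legendre_proj P s g c)"
      by (simp add: legendre_proj_def \<gamma>_def scaleR_sum_right)
    also have "(\<Sum>i<s. (if j = i then 1 else 0) *\<^sub>R \<gamma> i) = \<gamma> j"
      using that by (simp add: if_distrib[of "\<lambda>t. t *\<^sub>R _"] cong: if_cong)
    finally show ?thesis by (rule integral_unique)
  qed
  have "moment i (\<lambda>c. g c - legendre_proj P s g c)
      = integral {0..1} (\<lambda>c. \<Sum>j<s. a j *\<^sub>R (poly (P j) c *\<^sub>R g c - poly (P j) c *\<^sub>R legendre_proj P s g c))"
    unfolding moment_def q[symmetric]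
    by (simp add: a poly_sum scaleR_sum_left scaleR_diff_right sum_subtractf)
  also have "\<dots> = (\<Sum>j<s. integral {0..1} (\<lambda>c. a j *\<^sub>R (poly (P j) c *\<^sub>R g c - poly (P j) c *\<^sub>R legendre_proj P s g c)))"
    by (intro integral_sum integrable_continuous_real continuous_intros assms) auto
  also have "\<dots> = (\<Sum>j<s. a j *\<^sub>R (\<gamma> j - \<gamma> j))"
  proof (intro sum.cong refl)
    fix j assume "j \<in> {..<s}"
    have "integral {0..1} (\<lambda>c. poly (P j) c *\<^sub>R g c - poly (P j) c *\<^sub>R legendre_proj P s g c)
       = integral {0..1} (\<lambda>c. poly (P j) c *\<^sub>R g c) - integral {0..1} (\<lambda>c. poly (P j) c *\<^sub>R legendre_proj P s g c)"
      by (intro integral_diff integrable_continuous_real continuous_intros assms)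
    then show "integral {0..1} (\<lambda>c. a j *\<^sub>R (poly (P j) c *\<^sub>R g c - poly (P j) c *\<^sub>R legendre_proj P s g c)) = a j *\<^sub>R (\<gamma> j - \<gamma> j)"
      using P \<open>j \<in> {..<s}\<close> by (simp only: integral_cmul) (simp add: \<gamma>_def)
  qed
  finally show ?thesis by simp
qed

text \<open>The projection fixes polynomials of degree less than \<open>s\<close> and is bounded in the supremum norm, so the residual
is at most a constant times the distance to any such polynomial.\<close>
lemma legendre_residual_bound:
  assumes "orthonormal_legendre P"
  shows "\<exists>C\<ge>0. \<forall>(g :: real \<Rightarrow> 'a::euclidean_space) a B. continuous_on {0..1} g \<longrightarrow>
      (\<forall>x\<in>{0..1}. norm (g x - (\<Sum>j<s. (1 - x) ^ j *\<^sub>R a j)) \<le> B) \<longrightarrow>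
      (\<forall>c\<in>{0..1}. norm (g c - legendre_proj P s g c) \<le> C * B)"
proof -
  obtain C where C: "C \<ge> 0" "\<And>(g :: real \<Rightarrow> 'a) B c. continuous_on {0..1} g \<Longrightarrow>
      (\<forall>x\<in>{0..1}. norm (g x) \<le> B) \<Longrightarrow> c \<in> {0..1} \<Longrightarrow> norm (legendre_proj P s g c) \<le> C * B"
    using legendre_proj_bound[of P s] by blast
  have "norm (g c - legendre_proj P s g c) \<le> (1 + C) * B"
    if g: "continuous_on {0..1} g" and B: "\<forall>x\<in>{0..1}. norm (g x - (\<Sum>j<s. (1 - x) ^ j *\<^sub>R a j)) \<le> B"
      and c: "c \<in> {0..1}" for g :: "real \<Rightarrow> 'a" and a B c
  proof -
    let ?p = "\<lambda>x. \<Sum>j<s. (1 - x) ^ j *\<^sub>R a j"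
    have cp: "continuous_on {0..1} ?p" by (intro continuous_intros)
    have "legendre_proj P s ?p c = ?p c"
    proof -
      define q where "q j = [:1, -1::real:] ^ j" for j
      have q: "(1 - x) ^ j = poly (q j) x" for j and x :: real by (simp add: q_def)
      have dq: "degree (q j) \<le> j" for j unfolding q_def using degree_power_le[of "[:1, -1::real:]" j] by simp
      have "integral {0..1} (\<lambda>x. poly (P i) x *\<^sub>R (\<Sum>j<s. poly (q j) x *\<^sub>R a j))
          = (\<Sum>j<s. integral {0..1} (\<lambda>x. poly (P i) x *\<^sub>R poly (q j) x *\<^sub>R a j))" for i
        unfolding scaleR_sum_right by (intro integral_sum integrable_continuous_real continuous_intros) auto
      then have "legendre_proj P s ?p c = (\<Sum>i<s. \<Sum>j<s. poly (P i) c *\<^sub>R integral {0..1} (\<lambda>x. poly (P i) x *\<^sub>R poly (q j) x *\<^sub>R a j))"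
        by (simp add: legendre_proj_def q scaleR_sum_right)
      also have "\<dots> = (\<Sum>j<s. legendre_proj P s (\<lambda>x. poly (q j) x *\<^sub>R a j) c)"
        unfolding legendre_proj_def by (rule sum.swap)
      also have "\<dots> = (\<Sum>j<s. poly (q j) c *\<^sub>R a j)"
        using dq c by (intro sum.cong refl legendre_proj_poly assms) (auto intro: le_less_trans)
      finally show ?thesis by (simp add: q)
    qed
    then have eq: "g c - legendre_proj P s g c = (g c - ?p c) - legendre_proj P s (\<lambda>x. g x - ?p x) c"
      by (simp add: legendre_proj_diff[OF g cp])
    have "norm (legendre_proj P s (\<lambda>x. g x - ?p x) c) \<le> C * B"
      by (intro C(2)) (use B c in \<open>auto intro!: continuous_on_diff g cp\<close>)
    moreover have "norm (g c - ?p c) \<le> B" using B c by blast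
    ultimately have "norm (g c - legendre_proj P s g c) \<le> B + C * B"
      unfolding eq by (rule order_trans[OF norm_triangle_ineq4 add_mono, rotated])
    then show ?thesis by (simp add: distrib_right)
  qed
  then show ?thesis using C(1) by (intro exI[of _ "1 + C"]) auto
qed

section \<open>One step: error and existence\<close>

text \<open>Along a trajectory the difference \<open>f (z c) - f x\<close> is linear in the first component of \<open>z c - x\<close>, up to
the quadratic remainder, the second component (the memory error), and the Taylor remainder of the
partial derivatives of \<open>f\<close>, each of which is an observable of the smooth trajectory. Only the trajectory
\<open>z\<close> is expanded, because the derivatives of the numerical solution are not known to be bounded independently of \<open>h\<close>.\<close>
lemma flow_linearization:
  fixes f :: "('a::euclidean_space \<times> 'c::euclidean_space) \<Rightarrow> 'b::euclidean_space"
  assumes F: "C_inf F" and S: "compact S" "convex S" and f: "C_inf f"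
  shows "\<exists>M\<ge>0. \<forall>h z. 0 \<le> h \<and> z ` {0..1} \<subseteq> S \<and>
      (\<forall>c\<in>{0..1}. (z has_vector_derivative h *\<^sub>R F (z c)) (at c within {0..1})) \<longrightarrow>
      (\<exists>A :: nat \<Rightarrow> 'a \<Rightarrow> 'b. (\<forall>j<s. bounded_linear (A j) \<and> (\<forall>v. norm (A j v) \<le> M * norm v)) \<and>
        (\<forall>c\<in>{0..1}. \<forall>x\<in>S. norm (f (z c) - f x - (\<Sum>j<s. (h * (1 - c)) ^ j *\<^sub>R A j (fst (z c - x))))
          \<le> M * (norm (z c - x) ^ 2 + norm (snd (z c - x)) + h ^ s * norm (fst (z c - x)))))"
proof -
  let ?D = "\<lambda>x. frechet_derivative f (at x)"
  define g where "g b x = ?D x (b, 0)" for b x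
  have g: "C_inf (g b)" for b
    unfolding g_def by (rule C_inf_frechet_derivative[OF f])
  obtain Q where Q: "Q \<ge> 0" "\<And>x z. x \<in> S \<Longrightarrow> z \<in> S \<Longrightarrow> norm (f z - f x - ?D z (z - x)) \<le> Q * norm (z - x) ^ 2"
    using C_inf_quadratic_remainder[OF f S] by blast
  obtain L where L: "L \<ge> 0" "\<And>x v. x \<in> S \<Longrightarrow> norm (?D x v) \<le> L * norm v"
    using C_inf_derivative_bound[OF f S(1)] by blast
  define taylor_le where "taylor_le b C \<longleftrightarrow> (\<forall>h z. 0 \<le> h \<and> z ` {0..1} \<subseteq> S \<and>
      (\<forall>c\<in>{0..1}. (z has_vector_derivative h *\<^sub>R F (z c)) (at c within {0..1})) \<longrightarrow>
      (\<forall>c\<in>{0..1}. norm (g b (z c) - (\<Sum>j<s. ((h * (c - 1)) ^ j / fact j) *\<^sub>R (lie F ^^ j) (g b) (z 1))) \<le> C * h ^ s))"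
    for b C
  have "\<forall>b. \<exists>C. C \<ge> 0 \<and> taylor_le b C"
    unfolding taylor_le_def using flow_taylor_uniform[OF F S(1) g] by blast
  from choice[OF this] obtain T where T0: "\<forall>b. T b \<ge> 0 \<and> taylor_le b (T b)" ..
  have T: "T b \<ge> 0" "0 \<le> h \<Longrightarrow> z ` {0..1} \<subseteq> S \<Longrightarrow>
      (\<forall>c\<in>{0..1}. (z has_vector_derivative h *\<^sub>R F (z c)) (at c within {0..1})) \<Longrightarrow> c\<in>{0..1} \<Longrightarrow>
      norm (g b (z c) - (\<Sum>j<s. ((h * (c - 1)) ^ j / fact j) *\<^sub>R (lie F ^^ j) (g b) (z 1))) \<le> T b * h ^ s"
    for b h z c
    using T0 unfolding taylor_le_def by blast+
  have "\<exists>B\<ge>0. \<forall>i\<in>{..<s} \<times> Basis. \<forall>x. x \<in> S \<longrightarrow> norm ((lie F ^^ fst i) (g (snd i)) x) \<le> B"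
    using C_inf_bounded_on_compact[OF C_inf_lie_funpow[OF F g] S(1)]
    by (intro finite_family_bound) (simp_all add: Ball_def)
  then obtain B where B: "B \<ge> 0" "\<And>j b x. j < s \<Longrightarrow> b \<in> Basis \<Longrightarrow> x \<in> S \<Longrightarrow> norm ((lie F ^^ j) (g b) x) \<le> B"
    by fastforce
  define T' where "T' = (\<Sum>b\<in>Basis. T b)"
  have T': "T' \<ge> 0" unfolding T'_def by (intro sum_nonneg T)
  define M where "M = real DIM('a) * B + Q + L + T'"
  have M: "M \<ge> 0" "real DIM('a) * B \<le> M" "Q \<le> M" "L \<le> M" "T' \<le> M"
    unfolding M_def using B(1) Q(1) L(1) T' by auto
  have "\<exists>A :: nat \<Rightarrow> 'a \<Rightarrow> 'b. (\<forall>j<s. bounded_linear (A j) \<and> (\<forall>v. norm (A j v) \<le> M * norm v)) \<and>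
        (\<forall>c\<in>{0..1}. \<forall>x\<in>S. norm (f (z c) - f x - (\<Sum>j<s. (h * (1 - c)) ^ j *\<^sub>R A j (fst (z c - x))))
          \<le> M * (norm (z c - x) ^ 2 + norm (snd (z c - x)) + h ^ s * norm (fst (z c - x))))"
    if h: "0 \<le> h" and zS: "z ` {0..1} \<subseteq> S"
      and z: "\<forall>c\<in>{0..1}. (z has_vector_derivative h *\<^sub>R F (z c)) (at c within {0..1})"
    for h z
  proof -
    \<comment> \<open>The sign turns powers of \<open>c - 1\<close> from the Taylor expansion into powers of \<open>1 - c\<close>.\<close>
    define G where "G j b = ((-1) ^ j / fact j) *\<^sub>R (lie F ^^ j) (g b) (z 1)" for j b
    define A where "A j v = (\<Sum>b\<in>Basis. (v \<bullet> b) *\<^sub>R G j b)" for j and v :: 'a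
    have z1: "z 1 \<in> S" using zS by auto
    have G: "norm (G j b) \<le> B" if "j < s" "b \<in> Basis" for j b
    proof -
      have "norm (G j b) = (1 / fact j) * norm ((lie F ^^ j) (g b) (z 1))"
        by (simp add: G_def power_abs)
      also have "\<dots> \<le> 1 * B" using B that z1 by (intro mult_mono) (auto simp: fact_ge_1)
      finally show ?thesis by simp
    qed
    have Abl: "bounded_linear (A j)" for j
      unfolding A_def by (intro bounded_linear_sum bounded_linear_scaleR_const bounded_linear_inner_left)
    have An: "norm (A j v) \<le> M * norm v" if "j < s" for j v
    proof -
      have "norm (A j v) \<le> (\<Sum>b\<in>(Basis::'a set). norm v * B)"
        unfolding A_def using G that B(1) by (intro sum_norm_le) (auto intro!: mult_mono Basis_le_norm)
      also have "\<dots> = (real DIM('a) * B) * norm v" by simp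
      also have "\<dots> \<le> M * norm v" by (intro mult_right_mono M) auto
      finally show ?thesis .
    qed
    have main: "norm (f (z c) - f x - (\<Sum>j<s. (h * (1 - c)) ^ j *\<^sub>R A j (fst (z c - x))))
          \<le> M * (norm (z c - x) ^ 2 + norm (snd (z c - x)) + h ^ s * norm (fst (z c - x)))"
      if c: "c \<in> {0..1}" and x: "x \<in> S" for c x
    proof -
      define e where "e = fst (z c - x)"
      define E where "E = snd (z c - x)"
      have eE: "z c - x = (e, E)" by (simp only: e_def E_def prod.collapse)
      have zc: "z c \<in> S" using zS c by auto
      have lin: "linear (?D (z c))"
        using C_inf_has_derivative[OF f] has_derivative_linear by blast
      let ?R = "\<lambda>b. g b (z c) - (\<Sum>j<s. ((h * (c - 1)) ^ j / fact j) *\<^sub>R (lie F ^^ j) (g b) (z 1))"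
      have "(\<Sum>j<s. (h * (1 - c)) ^ j *\<^sub>R A j e)
          = (\<Sum>b\<in>Basis. (e \<bullet> b) *\<^sub>R (\<Sum>j<s. (h * (1 - c)) ^ j *\<^sub>R G j b))"
        unfolding A_def scaleR_sum_right by (subst sum.swap) (simp add: mult_ac)
      also have "\<dots> = (\<Sum>b\<in>Basis. (e \<bullet> b) *\<^sub>R (\<Sum>j<s. ((h * (c - 1)) ^ j / fact j) *\<^sub>R (lie F ^^ j) (g b) (z 1)))"
      proof -
        have "(h * (1 - c)) ^ j * (-1) ^ j = (h * (c - 1)) ^ j" for j
          by (simp add: power_mult_distrib[symmetric] algebra_simps)
        then show ?thesis by (simp add: G_def)
      qed
      finally have sumA: "(\<Sum>j<s. (h * (1 - c)) ^ j *\<^sub>R A j e)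
          = (\<Sum>b\<in>Basis. (e \<bullet> b) *\<^sub>R (\<Sum>j<s. ((h * (c - 1)) ^ j / fact j) *\<^sub>R (lie F ^^ j) (g b) (z 1)))" .
      have De: "?D (z c) (e, 0) = (\<Sum>b\<in>Basis. (e \<bullet> b) *\<^sub>R g b (z c))"
      proof -
        have l: "linear (\<lambda>v::'a. ?D (z c) (v, 0))"
          by (intro linear_compose[OF _ lin, unfolded o_def] linearI) auto
        have "?D (z c) (e, 0) = ?D (z c) (\<Sum>b\<in>Basis. (e \<bullet> b) *\<^sub>R b, 0)"
          by (simp add: euclidean_representation)
        also have "\<dots> = (\<Sum>b\<in>Basis. (e \<bullet> b) *\<^sub>R g b (z c))"
          unfolding g_def by (simp add: linear_sum[OF l] linear_scale[OF l])
        finally show ?thesis .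
      qed
      have "?D (z c) (e, E) = ?D (z c) (e, 0) + ?D (z c) (0, E)"
        by (simp add: linear_add[OF lin, symmetric])
      then have eq: "f (z c) - f x - (\<Sum>j<s. (h * (1 - c)) ^ j *\<^sub>R A j e)
          = (f (z c) - f x - ?D (z c) (z c - x)) + ?D (z c) (0, E) + (\<Sum>b\<in>Basis. (e \<bullet> b) *\<^sub>R ?R b)"
        unfolding eE sumA by (simp add: De scaleR_diff_right sum_subtractf)
      have n3: "norm (\<Sum>b\<in>Basis. (e \<bullet> b) *\<^sub>R ?R b) \<le> T' * (h ^ s * norm e)"
      proof -
        have "norm (\<Sum>b\<in>Basis. (e \<bullet> b) *\<^sub>R ?R b) \<le> (\<Sum>b\<in>(Basis::'a set). norm e * (T b * h ^ s))"
        proof (intro sum_norm_le)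
          fix b :: 'a assume "b \<in> Basis"
          then show "norm ((e \<bullet> b) *\<^sub>R ?R b) \<le> norm e * (T b * h ^ s)"
            unfolding norm_scaleR using T(2)[OF h zS z c, of b]
            by (intro mult_mono Basis_le_norm) (auto simp: Basis_le_norm)
        qed
        also have "\<dots> = T' * (h ^ s * norm e)"
          unfolding T'_def sum_distrib_right by (intro sum.cong) auto
        finally show ?thesis .
      qed
      have n2: "norm (?D (z c) (0, E)) \<le> L * norm E"
        using L(2)[OF zc, of "(0, E)"] by simp
      have "norm (f (z c) - f x - (\<Sum>j<s. (h * (1 - c)) ^ j *\<^sub>R A j e))
          \<le> Q * norm (z c - x) ^ 2 + L * norm E + T' * (h ^ s * norm e)"
        unfolding eq by (intro norm_triangle_mono Q(2)[OF x zc] n2 n3)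
      also have "\<dots> \<le> M * norm (z c - x) ^ 2 + M * norm E + M * (h ^ s * norm e)"
        using h by (intro add_mono mult_right_mono M) auto
      finally show ?thesis unfolding e_def E_def by (simp add: distrib_left)
    qed
    show ?thesis using Abl An main by blast
  qed
  then show ?thesis using M(1) by blast
qed

text \<open>One step of the exact solution \<open>u\<close> and of the approximation \<open>w\<close>, both as functions of \<open>c\<close> in the unit
interval and both inside a fixed ball; \<open>Y\<close> and \<open>S\<close> are their values at the last integer time.\<close>
definition step_pair :: "('a::euclidean_space \<times> 'a \<Rightarrow> 'a) \<Rightarrow> (nat \<Rightarrow> real poly) \<Rightarrow> nat \<Rightarrow> real \<Rightarrow> real
    \<Rightarrow> (real \<Rightarrow> 'a) \<Rightarrow> (real \<Rightarrow> 'a) \<Rightarrow> 'a \<Rightarrow> 'a \<Rightarrow> bool" where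
  "step_pair f P s R h u w Y S \<longleftrightarrow>
     0 < h \<and> u ` {0..1} \<subseteq> cball 0 R \<and> w ` {0..1} \<subseteq> cball 0 R \<and> Y \<in> cball 0 R \<and> S \<in> cball 0 R \<and>
     (\<forall>c\<in>{0..1}. (u has_vector_derivative h *\<^sub>R f (u c, Y)) (at c within {0..1})) \<and>
     (\<forall>c\<in>{0..1}. (w has_vector_derivative h *\<^sub>R legendre_proj P s (\<lambda>x. f (w x, S)) c) (at c within {0..1}))"

text \<open>With \<open>d = f (u, Y) - f (w, S)\<close>, the defect of \<open>w\<close> is the projection residual of \<open>f (u, Y)\<close> minus that
of \<open>d\<close>. The first is \<open>O(h ^ s)\<close> by Taylor expansion of the exact solution and the second is controlled by the
supremum \<open>m\<close> of the error. Integrating the error equation bounds \<open>m\<close> by the initial error plus \<open>h\<close> times a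
multiple of \<open>m\<close>, and that term is absorbed for small \<open>h\<close>.\<close>
lemma step_error_sup:
  fixes f :: "('a::euclidean_space \<times> 'a) \<Rightarrow> 'a"
  assumes f: "C_inf f" and P: "orthonormal_legendre P"
  shows "\<exists>C\<ge>0. \<exists>h0>0. h0 \<le> 1 \<and> (\<forall>h u w Y S. h \<le> h0 \<and> step_pair f P s R h u w Y S \<longrightarrow>
      (\<forall>c\<in>{0..1}. norm (u c - w c) \<le> C * (norm (u 0 - w 0) + norm (Y - S) + h ^ (s + 1)) \<and>
        norm (f (w c, S) - legendre_proj P s (\<lambda>x. f (w x, S)) c) \<le> C * (norm (u 0 - w 0) + norm (Y - S) + h ^ s)))"
proof -
  let ?S = "cball (0::'a) R \<times> cball (0::'a) R"
  have S: "compact ?S" "convex ?S" by (auto intro: compact_Times convex_Times)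
  define F where "F p = (f p, 0::'a)" for p
  have F: "C_inf F" unfolding F_def
    by (intro C_inf_bounded_linear[OF _ f] bounded_linear_Pair bounded_linear_ident bounded_linear_zero)
  obtain L where L: "L \<ge> 0" "\<And>x z. x \<in> ?S \<Longrightarrow> z \<in> ?S \<Longrightarrow> norm (f z - f x) \<le> L * norm (z - x)"
    using C_inf_lipschitz_on[OF f S] by blast
  obtain T where T: "T \<ge> 0" "\<And>h z c. 0 \<le> h \<Longrightarrow> z ` {0..1} \<subseteq> ?S \<Longrightarrow>
      (\<forall>c\<in>{0..1}. (z has_vector_derivative h *\<^sub>R F (z c)) (at c within {0..1})) \<Longrightarrow> c\<in>{0..1} \<Longrightarrow>
      norm (f (z c) - (\<Sum>j<s. ((h * (c - 1)) ^ j / fact j) *\<^sub>R (lie F ^^ j) f (z 1))) \<le> T * h ^ s"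
    using flow_taylor_uniform[OF F S(1) f, of s] by blast
  obtain C where C: "C \<ge> 0" "\<And>(g :: real \<Rightarrow> 'a) a B c. continuous_on {0..1} g \<Longrightarrow>
      (\<forall>x\<in>{0..1}. norm (g x - (\<Sum>j<s. (1 - x) ^ j *\<^sub>R a j)) \<le> B) \<Longrightarrow> c\<in>{0..1} \<Longrightarrow>
      norm (g c - legendre_proj P s g c) \<le> C * B"
    using legendre_residual_bound[OF P, of s] by blast
  define L1 where "L1 = L * (1 + C)"
  define T1 where "T1 = C * T"
  have L1: "L1 \<ge> 0" and T1: "T1 \<ge> 0" using L(1) C(1) T(1) by (auto simp: L1_def T1_def)
  \<comment> \<open>For \<open>h \<le> h0\<close> one has \<open>h * L1 \<le> 1 / 2\<close>, which is what the absorption of \<open>m\<close> uses.\<close>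
  define h0 where "h0 = 1 / (2 * L1 + 1)"
  define C1 where "C1 = 2 + 2 * T1"
  define C2 where "C2 = T1 + C * L * C1 + C * L"
  have C1: "C1 \<ge> 0" and C2: "C2 \<ge> 0" using L(1) C(1) T1 by (auto simp: C1_def C2_def)
  have h0: "0 < h0" "h0 \<le> 1" using L1 by (auto simp: h0_def divide_simps)
  have "norm (u c - w c) \<le> (C1 + C2) * (norm (u 0 - w 0) + norm (Y - S) + h ^ (s + 1)) \<and>
        norm (f (w c, S) - legendre_proj P s (\<lambda>x. f (w x, S)) c) \<le> (C1 + C2) * (norm (u 0 - w 0) + norm (Y - S) + h ^ s)"
    if hh0: "h \<le> h0" and pair: "step_pair f P s R h u w Y S" and c: "c \<in> {0..1}"
    for h u w Y S and c :: real
  proof -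
    have h: "0 < h" "h \<le> h0" and u: "u ` {0..1} \<subseteq> cball 0 R" and w: "w ` {0..1} \<subseteq> cball 0 R"
      and Y: "Y \<in> cball 0 R" and S': "S \<in> cball 0 R"
      and du: "\<forall>c\<in>{0..1}. (u has_vector_derivative h *\<^sub>R f (u c, Y)) (at c within {0..1})"
      and dw: "\<forall>c\<in>{0..1}. (w has_vector_derivative h *\<^sub>R legendre_proj P s (\<lambda>x. f (w x, S)) c) (at c within {0..1})"
      using hh0 pair by (auto simp: step_pair_def)
    let ?\<Pi> = "legendre_proj P s"
    define d where "d x = f (u x, Y) - f (w x, S)" for x
    define r where "r x = f (w x, S) - ?\<Pi> (\<lambda>x. f (w x, S)) x" for x
    define e where "e x = u x - w x" for x
    define E where "E = norm (Y - S)"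
    have E: "0 \<le> E" by (simp add: E_def)
    have cu: "continuous_on {0..1} u" and cw: "continuous_on {0..1} w"
      using du dw by (meson continuous_on_eq_continuous_within has_vector_derivative_continuous)+
    have ce: "continuous_on {0..1} e" unfolding e_def by (intro continuous_intros cu cw)
    have cfu: "continuous_on {0..1} (\<lambda>x. f (u x, Y))"
      by (rule continuous_on_compose2[OF C_inf_continuous[OF f, of UNIV]]) (auto intro!: continuous_intros cu)
    have cfw: "continuous_on {0..1} (\<lambda>x. f (w x, S))"
      by (rule continuous_on_compose2[OF C_inf_continuous[OF f, of UNIV]]) (auto intro!: continuous_intros cw)
    have cd: "continuous_on {0..1} d" unfolding d_def by (intro continuous_intros cfu cfw)
    obtain x0 where x0: "x0 \<in> {0..1}" "\<And>x. x \<in> {0..1} \<Longrightarrow> norm (e x) \<le> norm (e x0)"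
      using continuous_attains_sup[OF compact_Icc _ continuous_on_norm[OF ce]] by auto
    define m where "m = norm (e x0)"
    have m: "0 \<le> m" by (simp add: m_def)
    have d: "norm (d x) \<le> L * (m + E)" if x: "x \<in> {0..1}" for x
    proof -
      have "norm (d x) \<le> L * norm ((u x, Y) - (w x, S))"
        unfolding d_def using u w Y S' x by (intro L(2)) (auto simp: image_subset_iff)
      also have "\<dots> \<le> L * (norm (e x) + E)"
        unfolding e_def E_def using L(1) norm_Pair_le[of "u x - w x" "Y - S"] by (intro mult_left_mono) auto
      also have "\<dots> \<le> L * (m + E)" using x0(2)[OF x] L(1) by (auto simp: m_def intro!: mult_left_mono)
      finally show ?thesis .
    qed
    have resu: "norm (f (u x, Y) - ?\<Pi> (\<lambda>x. f (u x, Y)) x) \<le> T1 * h ^ s" if x: "x \<in> {0..1}" for x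
    proof -
      have "norm (f (u x, Y) - ?\<Pi> (\<lambda>x. f (u x, Y)) x) \<le> C * (T * h ^ s)"
      proof (rule C(2)[OF cfu _ x])
        show "\<forall>x\<in>{0..1}. norm (f (u x, Y) - (\<Sum>j<s. (1 - x) ^ j *\<^sub>R (((- h) ^ j / fact j) *\<^sub>R (lie F ^^ j) f (u 1, Y)))) \<le> T * h ^ s"
        proof
          fix x :: real assume x: "x \<in> {0..1}"
          have "norm (f (u x, Y) - (\<Sum>j<s. ((h * (x - 1)) ^ j / fact j) *\<^sub>R (lie F ^^ j) f (u 1, Y))) \<le> T * h ^ s"
            using du h u Y by (intro T(2)[of h "\<lambda>x. (u x, Y)", OF _ _ _ x])
              (auto simp: F_def intro!: derivative_eq_intros)
          moreover have "(h * (x - 1)) ^ j = (1 - x) ^ j * (- h) ^ j" for j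
            by (simp add: power_mult_distrib[symmetric] algebra_simps)
          ultimately show "norm (f (u x, Y) - (\<Sum>j<s. (1 - x) ^ j *\<^sub>R (((- h) ^ j / fact j) *\<^sub>R (lie F ^^ j) f (u 1, Y)))) \<le> T * h ^ s"
            by simp
        qed
      qed
      then show ?thesis by (simp add: T1_def mult_ac)
    qed
    \<comment> \<open>The difference \<open>d\<close> is small itself, so it is compared with the zero polynomial.\<close>
    have resd: "norm (d x - ?\<Pi> d x) \<le> C * (L * (m + E))" if x: "x \<in> {0..1}" for x
      by (rule C(2)[OF cd _ x, of "\<lambda>_. 0"]) (simp add: d)
    have r: "norm (r x) \<le> T1 * h ^ s + C * (L * (m + E))" if x: "x \<in> {0..1}" for x
    proof -
      have "r x = (f (u x, Y) - ?\<Pi> (\<lambda>x. f (u x, Y)) x) - (d x - ?\<Pi> d x)"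
        unfolding r_def d_def legendre_proj_diff[OF cfu cfw] by simp
      then show ?thesis using order_trans[OF norm_triangle_ineq4 add_mono[OF resu[OF x] resd[OF x]]] by simp
    qed
    have de: "(e has_vector_derivative h *\<^sub>R (d x + r x)) (at x within {0..1})" if x: "x \<in> {0..1}" for x
    proof -
      have "(e has_vector_derivative h *\<^sub>R f (u x, Y) - h *\<^sub>R ?\<Pi> (\<lambda>x. f (w x, S)) x) (at x within {0..1})"
        unfolding e_def using du dw x by (intro has_vector_derivative_diff) auto
      then show ?thesis by (simp add: d_def r_def scaleR_diff_right)
    qed
    define K where "K = h * (L1 * (m + E) + T1 * h ^ s)"
    have K: "0 \<le> K" using h L1 T1 m E by (simp add: K_def)
    have "norm (h *\<^sub>R (d x + r x)) \<le> K" if x: "x \<in> {0..1}" for x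
    proof -
      have "norm (d x + r x) \<le> L1 * (m + E) + T1 * h ^ s"
        using norm_triangle_le[OF add_mono[OF d[OF x] r[OF x]]] by (simp add: L1_def algebra_simps)
      then show ?thesis using h by (simp add: K_def)
    qed
    then have "norm (e x0 - e 0) \<le> K * norm (x0 - 0)"
      using de x0(1) K unfolding has_vector_derivative_def
      by (intro differentiable_bound[of "{0..1}" e "\<lambda>x t. t *\<^sub>R (h *\<^sub>R (d x + r x))"])
        (auto intro!: onorm_bound simp: mult.commute[of "\<bar>_\<bar>"] mult_right_mono simp del: scaleR_scaleR)
    also have "\<dots> \<le> K * 1" using x0(1) K by (intro mult_left_mono) auto
    finally have "m \<le> norm (e 0) + K"
      using norm_triangle_sub[of "e x0" "e 0"] by (simp add: m_def)
    moreover have "K \<le> (m + E) / 2 + T1 * h ^ (s + 1)"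
    proof -
      have "h * (2 * L1 + 1) \<le> 1" using h(2) L1 by (simp add: h0_def field_simps)
      then have "h * L1 \<le> 1 / 2" using h(1) by (simp add: algebra_simps)
      then have "h * L1 * (m + E) \<le> 1 / 2 * (m + E)" using m E by (intro mult_right_mono) auto
      then show ?thesis by (simp add: K_def algebra_simps)
    qed
    ultimately have "m \<le> 2 * norm (e 0) + E + 2 * T1 * h ^ (s + 1)" by (simp add: field_simps)
    also have "\<dots> \<le> C1 * norm (e 0) + C1 * E + C1 * h ^ (s + 1)"
      using T1 E h(1) by (intro add_mono mult_right_mono mult_right_mono[of 1 C1 E, simplified]) (auto simp: C1_def)
    finally have mb: "m \<le> C1 * (norm (e 0) + E + h ^ (s + 1))" by (simp add: algebra_simps)
    have hs: "h ^ (s + 1) \<le> h ^ s" using h h0 by (intro power_decreasing) auto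
    define X where "X = norm (e 0) + E + h ^ s"
    have X: "0 \<le> X" "E \<le> X" "h ^ s \<le> X" using E h by (auto simp: X_def)
    have "m \<le> C1 * X" using mult_left_mono[OF _ C1, of "norm (e 0) + E + h ^ (s + 1)" X] mb hs by (simp add: X_def)
    then have "norm (r c) \<le> T1 * X + C * (L * (C1 * X + X))"
      using r[OF c] X T1 C(1) L(1)
      by (elim order_trans) (intro add_mono mult_left_mono)
    also have "\<dots> = C2 * X" by (simp add: C2_def algebra_simps)
    also have "\<dots> \<le> (C1 + C2) * X" using C1 X by (intro mult_right_mono) auto
    finally have 2: "norm (r c) \<le> (C1 + C2) * X" .
    have "norm (e c) \<le> C1 * (norm (e 0) + E + h ^ (s + 1))" using x0(2)[OF c] mb by (simp add: m_def)
    also have "\<dots> \<le> (C1 + C2) * (norm (e 0) + E + h ^ (s + 1))" using C2 E h by (intro mult_right_mono) auto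
    finally show ?thesis using 2 by (simp add: e_def E_def r_def X_def)
  qed
  moreover have "0 \<le> C1 + C2" using C1 C2 by simp
  ultimately show ?thesis using h0 by blast
qed

text \<open>The a priori bound puts the step into the form of a perturbed linear step: the square of the error
\<open>O(D + h ^ (s + 1))\<close> is \<open>O(D + h ^ (2 * s))\<close>, where one factor of \<open>D\<^sup>2\<close> is estimated by the size of the ball.\<close>
lemma one_step_error:
  fixes f :: "('a::euclidean_space \<times> 'a) \<Rightarrow> 'a"
  assumes f: "C_inf f" and P: "orthonormal_legendre P" and s: "0 < s"
  shows "\<exists>C\<ge>0. \<exists>h0>0. \<forall>h u w Y S. h \<le> h0 \<and> step_pair f P s R h u w Y S \<longrightarrow>
      norm ((u 1 - w 1) - (u 0 - w 0)) \<le> C * h * (norm (u 0 - w 0) + norm (Y - S) + h ^ (2 * s)) \<and>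
      (\<forall>c\<in>{0..1}. norm (u c - w c) \<le> C * (norm (u 0 - w 0) + norm (Y - S) + h ^ (s + 1)))"
proof -
  let ?S = "cball (0::'a) R \<times> cball (0::'a) R"
  have S: "compact ?S" "convex ?S" by (auto intro: compact_Times convex_Times)
  define F where "F p = (f p, 0::'a)" for p
  have F: "C_inf F" unfolding F_def
    by (intro C_inf_bounded_linear[OF _ f] bounded_linear_Pair bounded_linear_ident bounded_linear_zero)
  obtain C1 h0 where C1: "C1 \<ge> 0" and h0: "h0 > 0" "h0 \<le> 1" and sup:
    "\<And>h u w Y S c. h \<le> h0 \<Longrightarrow> step_pair f P s R h u w Y S \<Longrightarrow> c \<in> {0..1} \<Longrightarrow>
        norm (u c - w c) \<le> C1 * (norm (u 0 - w 0) + norm (Y - S) + h ^ (s + 1)) \<and>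
        norm (f (w c, S) - legendre_proj P s (\<lambda>x. f (w x, S)) c) \<le> C1 * (norm (u 0 - w 0) + norm (Y - S) + h ^ s)"
    using step_error_sup[OF f P, where R = R and s = s] by blast
  obtain M1 where M1: "M1 \<ge> 0" and lin: "\<And>h z. 0 \<le> h \<Longrightarrow> z ` {0..1} \<subseteq> ?S \<Longrightarrow>
      (\<forall>c\<in>{0..1}. (z has_vector_derivative h *\<^sub>R F (z c)) (at c within {0..1})) \<Longrightarrow>
      (\<exists>A :: nat \<Rightarrow> 'a \<Rightarrow> 'a. (\<forall>j<s. bounded_linear (A j) \<and> (\<forall>v. norm (A j v) \<le> M1 * norm v)) \<and>
        (\<forall>c\<in>{0..1}. \<forall>x\<in>?S. norm (f (z c) - f x - (\<Sum>j<s. (h * (1 - c)) ^ j *\<^sub>R A j (fst (z c - x))))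
          \<le> M1 * (norm (z c - x) ^ 2 + norm (snd (z c - x)) + h ^ s * norm (fst (z c - x)))))"
    using flow_linearization[OF F S f, of s] by blast
  define R' where "R' = max R 0"
  define N where "N = 2 * (C1 + 1)\<^sup>2 * (4 * R' + 1) + 1 + C1"
  have N: "N \<ge> 0" using C1 by (simp add: N_def R'_def)
  define M where "M = C1 + M1 + M1 * N"
  have M: "M \<ge> 0" "C1 \<le> M" "M1 \<le> M" "M1 * N \<le> M" using C1 M1 N by (auto simp: M_def)
  obtain C where C: "C \<ge> 0" and inc: "\<And>h D (A :: nat \<Rightarrow> 'a \<Rightarrow> 'a) e d r. perturbed_step M s h D A e d r \<Longrightarrow>
      norm (e 1 - e 0) \<le> C * h * (D + h ^ (2 * s))"
    using perturbed_step_increment[OF M(1) s] by blast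
  have "norm ((u 1 - w 1) - (u 0 - w 0)) \<le> (C + C1) * h * (norm (u 0 - w 0) + norm (Y - S) + h ^ (2 * s)) \<and>
      (\<forall>c\<in>{0..1}. norm (u c - w c) \<le> (C + C1) * (norm (u 0 - w 0) + norm (Y - S) + h ^ (s + 1)))"
    if hh0: "h \<le> h0" and pair: "step_pair f P s R h u w Y S" for h u w Y S
  proof -
    have h: "0 < h" "h \<le> 1" and u: "u ` {0..1} \<subseteq> cball 0 R" and w: "w ` {0..1} \<subseteq> cball 0 R"
      and Y: "Y \<in> cball 0 R" and S': "S \<in> cball 0 R"
      and du: "\<forall>c\<in>{0..1}. (u has_vector_derivative h *\<^sub>R f (u c, Y)) (at c within {0..1})"
      and dw: "\<forall>c\<in>{0..1}. (w has_vector_derivative h *\<^sub>R legendre_proj P s (\<lambda>x. f (w x, S)) c) (at c within {0..1})"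
      using hh0 h0 pair by (auto simp: step_pair_def)
    define e where "e c = u c - w c" for c
    define d where "d c = f (u c, Y) - f (w c, S)" for c
    define r where "r c = f (w c, S) - legendre_proj P s (\<lambda>x. f (w x, S)) c" for c
    define D where "D = norm (e 0) + norm (Y - S)"
    have D0: "0 \<le> D" "norm (e 0) \<le> D" "norm (Y - S) \<le> D" by (auto simp: D_def)
    have D4: "D \<le> 4 * R'"
    proof -
      have "norm (u 0) \<le> R" "norm (w 0) \<le> R" "norm Y \<le> R" "norm S \<le> R"
        using u w Y S' by (auto simp: image_subset_iff)
      then show ?thesis
        using norm_triangle_ineq4[of "u 0" "w 0"] norm_triangle_ineq4[of Y S] by (simp add: D_def e_def R'_def)
    qed
    have cu: "continuous_on {0..1} u" and cw: "continuous_on {0..1} w"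
      using du dw by (meson continuous_on_eq_continuous_within has_vector_derivative_continuous)+
    have cfu: "continuous_on {0..1} (\<lambda>x. f (u x, Y))"
      by (rule continuous_on_compose2[OF C_inf_continuous[OF f, of UNIV]]) (auto intro!: continuous_intros cu)
    have cfw: "continuous_on {0..1} (\<lambda>x. f (w x, S))"
      by (rule continuous_on_compose2[OF C_inf_continuous[OF f, of UNIV]]) (auto intro!: continuous_intros cw)
    have ec: "norm (e c) \<le> C1 * (D + h ^ (s + 1))" and rc: "norm (r c) \<le> C1 * (D + h ^ s)" if "c \<in> {0..1}" for c
      using sup[OF hh0 pair that] by (auto simp: e_def r_def D_def)
    have hs: "h ^ (s + 1) \<le> h ^ s" using h by (intro power_decreasing) auto
    have "\<exists>A :: nat \<Rightarrow> 'a \<Rightarrow> 'a. (\<forall>j<s. bounded_linear (A j) \<and> (\<forall>v. norm (A j v) \<le> M1 * norm v)) \<and>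
        (\<forall>c\<in>{0..1}. \<forall>x\<in>?S. norm (f (u c, Y) - f x - (\<Sum>j<s. (h * (1 - c)) ^ j *\<^sub>R A j (fst ((u c, Y) - x))))
          \<le> M1 * (norm ((u c, Y) - x) ^ 2 + norm (snd ((u c, Y) - x)) + h ^ s * norm (fst ((u c, Y) - x))))"
      by (rule lin) (use h u Y du in \<open>auto simp: F_def intro!: derivative_eq_intros\<close>)
    then obtain A :: "nat \<Rightarrow> 'a \<Rightarrow> 'a" where A: "\<And>j. j < s \<Longrightarrow> bounded_linear (A j)"
      "\<And>j v. j < s \<Longrightarrow> norm (A j v) \<le> M1 * norm v"
      and dA: "\<And>c x. c \<in> {0..1} \<Longrightarrow> x \<in> ?S \<Longrightarrow> norm (f (u c, Y) - f x - (\<Sum>j<s. (h * (1 - c)) ^ j *\<^sub>R A j (fst ((u c, Y) - x))))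
          \<le> M1 * (norm ((u c, Y) - x) ^ 2 + norm (snd ((u c, Y) - x)) + h ^ s * norm (fst ((u c, Y) - x)))"
      by blast
    define X where "X = D + h ^ (2 * s)"
    have X: "0 \<le> X" "D \<le> X" "h ^ (2 * s) \<le> X" using D0 h by (auto simp: X_def)
    have hp1: "h ^ s \<le> 1" "h ^ (s + 1) \<le> 1" using h by (auto intro!: power_le_one simp del: power_Suc)
    have rest: "norm (d c - (\<Sum>j<s. (h * (1 - c)) ^ j *\<^sub>R A j (e c))) \<le> M * X" if c: "c \<in> {0..1}" for c
    proof -
      have "(w c, S) \<in> ?S" using w S' c by (auto simp: image_subset_iff)
      from dA[OF c this] have "norm (d c - (\<Sum>j<s. (h * (1 - c)) ^ j *\<^sub>R A j (e c)))
          \<le> M1 * (norm (e c, Y - S) ^ 2 + norm (Y - S) + h ^ s * norm (e c))"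
        by (simp add: d_def e_def)
      also have "\<dots> \<le> M1 * (2 * (C1 + 1)\<^sup>2 * (4 * R' + 1) * X + X + C1 * X)"
      proof (intro mult_left_mono add_mono M1)
        have "norm (e c, Y - S) \<le> C1 * (D + h ^ (s + 1)) + (D + h ^ (s + 1))"
          using norm_Pair_le[of "e c" "Y - S"] ec[OF c] D0 h zero_le_power[of h "s + 1"] by linarith
        then have "norm (e c, Y - S) ^ 2 \<le> ((C1 + 1) * (D + h ^ (s + 1))) ^ 2"
          by (intro power_mono) (auto simp: algebra_simps)
        also have "\<dots> = (C1 + 1)\<^sup>2 * (D + h ^ (s + 1))\<^sup>2" by (rule power_mult_distrib)
        also have "\<dots> \<le> (C1 + 1)\<^sup>2 * (2 * ((4 * R' + 1) * X))"
        proof (intro mult_left_mono)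
          have "(D + h ^ (s + 1))\<^sup>2 \<le> 2 * (D\<^sup>2 + (h ^ (s + 1))\<^sup>2)"
            using sum_squares_ge_zero[of "D - h ^ (s + 1)" 0] by (simp add: power2_eq_square algebra_simps)
          also have "D\<^sup>2 + (h ^ (s + 1))\<^sup>2 \<le> 4 * R' * X + 1 * X"
          proof (intro add_mono)
            show "D\<^sup>2 \<le> 4 * R' * X" unfolding power2_eq_square
              using D0 D4 X by (intro mult_mono) (auto simp: R'_def)
            have "(h ^ (s + 1))\<^sup>2 = h ^ (2 * s + 2)" unfolding power_mult[symmetric] by (rule arg_cong[of "(s + 1) * 2" "2 * s + 2" "(^) h"]) simp
            also have "\<dots> \<le> h ^ (2 * s)" using h by (intro power_decreasing) auto
            finally show "(h ^ (s + 1))\<^sup>2 \<le> 1 * X" using X by simp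
          qed
          finally show "(D + h ^ (s + 1))\<^sup>2 \<le> 2 * ((4 * R' + 1) * X)" by (simp add: algebra_simps)
        qed simp
        finally show "norm (e c, Y - S) ^ 2 \<le> 2 * (C1 + 1)\<^sup>2 * (4 * R' + 1) * X" by (simp only: mult_ac)
        show "norm (Y - S) \<le> X" using D0 X by simp
        have "h ^ s * norm (e c) \<le> h ^ s * (C1 * (D + h ^ s))"
          using ec[OF c] hs C1 h by (intro mult_left_mono) (auto elim!: order_trans intro!: mult_left_mono)
        also have "\<dots> = C1 * (h ^ s * D + h ^ (2 * s))"
          by (simp add: mult_2 power_add distrib_left mult.left_commute[of "h ^ s" C1])
        also have "\<dots> \<le> C1 * X" unfolding X_def
          using h D0 C1 hp1 by (intro mult_left_mono add_mono) (auto simp: mult_left_le_one_le)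
        finally show "h ^ s * norm (e c) \<le> C1 * X" .
      qed
      also have "\<dots> = M1 * N * X" by (simp add: N_def algebra_simps)
      also have "\<dots> \<le> M * X" using X M by (intro mult_right_mono) auto
      finally show ?thesis .
    qed
    have "perturbed_step M s h D A e d r"
      unfolding perturbed_step_def
    proof (intro conjI ballI allI impI)
      fix c :: real assume c: "c \<in> {0..1}"
      show "(e has_vector_derivative h *\<^sub>R (d c + r c)) (at c within {0..1})"
      proof -
        have "(e has_vector_derivative h *\<^sub>R f (u c, Y) - h *\<^sub>R legendre_proj P s (\<lambda>x. f (w x, S)) c) (at c within {0..1})"
          unfolding e_def using du dw c by (intro has_vector_derivative_diff) auto
        then show ?thesis by (simp add: d_def r_def scaleR_diff_right)
      qed
      have "C1 * (D + h ^ (s + 1)) \<le> M * (D + h ^ s)"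
        using M D0 hs h by (intro mult_mono) auto
      then show "norm (e c) \<le> M * (D + h ^ s)" using ec[OF c] by linarith
      have "C1 * (D + h ^ s) \<le> M * (D + h ^ s)" using M D0 h by (intro mult_right_mono) auto
      then show "norm (r c) \<le> M * (D + h ^ s)" using rc[OF c] by linarith
      show "norm (d c - (\<Sum>j<s. (h * (1 - c)) ^ j *\<^sub>R A j (e c))) \<le> M * (D + h ^ (2 * s))"
        using rest[OF c] by (simp add: X_def)
    next
      fix j assume "j < s"
      then show "bounded_linear (A j)" using A by blast
      fix v :: 'a
      have "M1 * norm v \<le> M * norm v" using M by (intro mult_right_mono) auto
      then show "norm (A j v) \<le> M * norm v" using A(2)[OF \<open>j < s\<close>, of v] by linarith
    next
      fix i assume "i < s"
      then show "moment i r = 0" unfolding r_def by (rule moment_legendre_residual[OF P cfw])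
    next
      show "continuous_on {0..1} d" unfolding d_def by (intro continuous_intros cfu cfw)
      show "continuous_on {0..1} r" unfolding r_def by (intro continuous_intros cfw)
    qed (use h D0 in auto)
    from inc[OF this] have "norm (e 1 - e 0) \<le> C * h * X" by (simp add: X_def)
    also have "\<dots> \<le> (C + C1) * h * X" using C C1 h X by (intro mult_right_mono) auto
    finally have 1: "norm (e 1 - e 0) \<le> (C + C1) * h * X" .
    have "C1 * (D + h ^ (s + 1)) \<le> (C + C1) * (D + h ^ (s + 1))"
      using C D0 h by (intro mult_right_mono) auto
    then have "norm (e c) \<le> (C + C1) * (D + h ^ (s + 1))" if "c \<in> {0..1}" for c
      using ec[OF that] by linarith
    then show ?thesis using 1 by (simp add: e_def D_def X_def)
  qed
  moreover have "0 \<le> C + C1" using C C1 by simp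
  ultimately show ?thesis using h0 by blast
qed

text \<open>Picard iteration on continuous functions: on functions at distance at most 1 from the constant \<open>a\<close> the
right-hand side is bounded and Lipschitz, so the integral operator is a contraction of that set into itself once \<open>h\<close> is small.
Functions are clamped to the unit interval to work in the complete space of bounded continuous functions on the line.\<close>
lemma legendre_step_exists:
  fixes f :: "('a::euclidean_space \<times> 'a) \<Rightarrow> 'a"
  assumes f: "C_inf f"
  shows "\<exists>h0>0. \<forall>h a S. 0 < h \<and> h \<le> h0 \<and> a \<in> cball 0 R \<and> S \<in> cball 0 R \<longrightarrow>
      (\<exists>w. w 0 = a \<and> w ` {0..1} \<subseteq> cball 0 (R + 1) \<and>
        (\<forall>c\<in>{0..1}. (w has_vector_derivative h *\<^sub>R legendre_proj P s (\<lambda>x. f (w x, S)) c) (at c within {0..1})))"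
proof -
  let ?B = "cball (0::'a) (R + 1) \<times> cball (0::'a) (R + 1)"
  let ?\<Pi> = "legendre_proj P s :: (real \<Rightarrow> 'a) \<Rightarrow> real \<Rightarrow> 'a"
  have comp: "compact ?B" "convex ?B" by (auto intro: compact_Times convex_Times)
  obtain B where B: "B \<ge> 0" "\<And>x. x \<in> ?B \<Longrightarrow> norm (f x) \<le> B"
    using C_inf_bounded_on_compact[OF f comp(1)] by blast
  obtain L where L: "L \<ge> 0" "\<And>x z. x \<in> ?B \<Longrightarrow> z \<in> ?B \<Longrightarrow> norm (f z - f x) \<le> L * norm (z - x)"
    using C_inf_lipschitz_on[OF f comp] by blast
  obtain C where C: "C \<ge> 0" "\<And>(g :: real \<Rightarrow> 'a) B c. continuous_on {0..1} g \<Longrightarrow>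
      (\<forall>x\<in>{0..1}. norm (g x) \<le> B) \<Longrightarrow> c \<in> {0..1} \<Longrightarrow> norm (?\<Pi> g c) \<le> C * B"
    using legendre_proj_bound[of P s] by blast
  define h0 where "h0 = 1 / (2 * (C * B + C * L) + 1)"
  have h0: "0 < h0" using B(1) L(1) C(1) by (simp add: h0_def add_nonneg_pos)
  have "\<exists>w. w 0 = a \<and> w ` {0..1} \<subseteq> cball 0 (R + 1) \<and>
        (\<forall>c\<in>{0..1}. (w has_vector_derivative h *\<^sub>R ?\<Pi> (\<lambda>x. f (w x, S)) c) (at c within {0..1}))"
    if h: "0 < h" "h \<le> h0" and a: "a \<in> cball 0 R" and S: "S \<in> cball 0 R" for h a S
  proof -
    have hC: "h * (C * B) \<le> 1" "h * (C * L) \<le> 1 / 2"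
    proof -
      have "h * (2 * (C * B + C * L) + 1) \<le> 1"
        using h(2) B(1) L(1) C(1) by (simp add: h0_def add_nonneg_pos le_divide_eq)
      moreover have "0 \<le> h * (C * B)" "0 \<le> h * (C * L)" using h B(1) L(1) C(1) by auto
      ultimately show "h * (C * B) \<le> 1" "h * (C * L) \<le> 1 / 2" using h(1) by (simp_all add: algebra_simps)
    qed
    define cl where "cl c = max 0 (min 1 c)" for c :: real
    have cl: "cl c \<in> {0..1}" "c \<in> {0..1} \<Longrightarrow> cl c = c" for c by (auto simp: cl_def)
    have ccl: "continuous_on UNIV cl" unfolding cl_def by (intro continuous_intros)
    define I where "I g c = integral {0..c} (?\<Pi> g)" for g c
    have cI: "continuous_on {0..1} (I g)" for g
      unfolding I_def by (intro indefinite_integral_continuous_1 integrable_continuous_real continuous_intros)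
    have Ile: "norm (I g c) \<le> C * b"
      if g: "continuous_on {0..1} g" "\<forall>x\<in>{0..1}. norm (g x) \<le> b" and c: "c \<in> {0..1}" for g b c
    proof -
      have "0 \<le> C * b" using order_trans[OF norm_ge_zero C(2)[OF g c]] .
      have "norm (I g c) \<le> C * b * (c - 0)"
        unfolding I_def using C(2)[OF g] c by (intro integral_bound continuous_intros) auto
      also have "\<dots> \<le> C * b * 1" using c \<open>0 \<le> C * b\<close> by (intro mult_left_mono) auto
      finally show ?thesis by simp
    qed
    define T where "T v c = a + h *\<^sub>R I (\<lambda>x. f (apply_bcontfun v x, S)) (cl c)" for v :: "real \<Rightarrow>\<^sub>C 'a" and c
    have cf: "continuous_on {0..1} (\<lambda>x. f (apply_bcontfun v x, S))" for v :: "real \<Rightarrow>\<^sub>C 'a"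
      by (rule continuous_on_compose2[OF C_inf_continuous[OF f, of UNIV]]) (auto intro!: continuous_intros)
    have Tb: "T v \<in> bcontfun" for v
    proof -
      have "bounded (I (\<lambda>x. f (apply_bcontfun v x, S)) ` {0..1})"
        by (intro compact_imp_bounded compact_continuous_image cI) auto
      then obtain b where b: "\<And>c. c \<in> {0..1} \<Longrightarrow> norm (I (\<lambda>x. f (apply_bcontfun v x, S)) c) \<le> b"
        unfolding bounded_iff by blast
      show ?thesis
      proof (rule bcontfun_normI)
        show "continuous_on UNIV (T v)" unfolding T_def
          by (intro continuous_intros continuous_on_compose2[OF cI ccl]) (use cl in auto)
        show "norm (T v c) \<le> norm a + h * b" for c
          unfolding T_def using b[OF cl(1)] h by (intro norm_triangle_mono) auto
      qed
    qed
    define U where "U v = Bcontfun (T v)" for v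
    have U: "apply_bcontfun (U v) = T v" for v
      unfolding U_def by (rule Bcontfun_inverse[OF Tb])
    define X where "X = cball (const_bcontfun a :: real \<Rightarrow>\<^sub>C 'a) 1"
    have vX: "(apply_bcontfun v x, S) \<in> ?B" if "v \<in> X" for v x
    proof -
      have "dist a (apply_bcontfun v x) \<le> 1"
        using that dist_bounded[of "const_bcontfun a" x v] by (simp add: X_def const_bcontfun.rep_eq)
      then have "norm (apply_bcontfun v x) \<le> norm a + 1"
        using norm_triangle_sub[of "apply_bcontfun v x" a] by (simp add: dist_norm norm_minus_commute)
      then show ?thesis using a S by auto
    qed
    have "\<exists>!v\<in>X. U v = v"
    proof (rule Banach_fix[where c = "1/2"])
      show "complete X" unfolding X_def complete_eq_closed by simp
      show "X \<noteq> {}" by (simp add: X_def)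
      show "U ` X \<subseteq> X"
      proof
        fix t assume "t \<in> U ` X"
        then obtain v where v: "v \<in> X" and t: "t = U v" by auto
        have "dist (const_bcontfun a) (U v) \<le> 1"
        proof (rule dist_bound)
          fix c
          have "norm (h *\<^sub>R I (\<lambda>x. f (apply_bcontfun v x, S)) (cl c)) \<le> h * (C * B)"
            using Ile[OF cf _ cl(1), of v B c] B(2)[OF vX[OF v]] h by simp
          then show "dist (apply_bcontfun (const_bcontfun a) c) (apply_bcontfun (U v) c) \<le> 1"
            using hC by (simp add: U T_def dist_norm const_bcontfun.rep_eq)
        qed
        then show "t \<in> X" by (simp add: X_def t)
      qed
      show "dist (U v) (U v') \<le> 1 / 2 * dist v v'" if v: "v \<in> X" "v' \<in> X" for v v'
      proof (rule dist_bound)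
        fix c
        let ?g = "\<lambda>v x. f (apply_bcontfun v x, S)"
        have "I (?g v) (cl c) - I (?g v') (cl c) = I (\<lambda>x. ?g v x - ?g v' x) (cl c)"
        proof -
          have "I (\<lambda>x. ?g v x - ?g v' x) (cl c) = integral {0..cl c} (\<lambda>x. ?\<Pi> (?g v) x - ?\<Pi> (?g v') x)"
            unfolding I_def by (intro integral_cong legendre_proj_diff cf)
          then show ?thesis
            unfolding I_def by (simp add: integral_diff integrable_continuous_real continuous_on_legendre_proj)
        qed
        moreover have "norm (I (\<lambda>x. ?g v x - ?g v' x) (cl c)) \<le> C * (L * dist v v')"
        proof (rule Ile[OF _ _ cl(1)])
          show "\<forall>x\<in>{0..1}. norm (?g v x - ?g v' x) \<le> L * dist v v'"
          proof
            fix x :: real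
            have "norm (?g v x - ?g v' x) \<le> L * norm ((apply_bcontfun v x, S) - (apply_bcontfun v' x, S))"
              by (intro L(2) vX v)
            also have "\<dots> \<le> L * dist v v'"
              using L(1) dist_bounded[of v x v'] by (intro mult_left_mono) (auto simp: dist_norm)
            finally show "norm (?g v x - ?g v' x) \<le> L * dist v v'" .
          qed
        qed (intro continuous_intros cf)
        ultimately have "dist (T v c) (T v' c) \<le> h * (C * (L * dist v v'))"
          using h by (simp add: T_def dist_norm flip: scaleR_diff_right)
        also have "\<dots> = h * (C * L) * dist v v'" by simp
        also have "\<dots> \<le> 1 / 2 * dist v v'" using hC by (intro mult_right_mono) auto
        finally show "dist (apply_bcontfun (U v) c) (apply_bcontfun (U v') c) \<le> 1 / 2 * dist v v'" by (simp add: U)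
      qed
    qed auto
    then obtain v where v: "v \<in> X" "U v = v" by blast
    define w where "w = apply_bcontfun v"
    have wc: "w c = a + h *\<^sub>R I (\<lambda>x. f (w x, S)) (cl c)" for c
      using fun_cong[OF U[of v], of c] unfolding v(2) T_def w_def .
    have wI: "w x = a + h *\<^sub>R I (\<lambda>x. f (w x, S)) x" if "x \<in> {0..1}" for x
      using wc[of x] unfolding cl(2)[OF that] .
    have "w 0 = a" using wc[of 0] cl(2)[of 0] by (simp add: I_def)
    moreover have "w ` {0..1} \<subseteq> cball 0 (R + 1)" using vX[OF v(1)] by (auto simp: w_def)
    moreover have "(w has_vector_derivative h *\<^sub>R ?\<Pi> (\<lambda>x. f (w x, S)) c) (at c within {0..1})" if c: "c \<in> {0..1}" for c
    proof -
      have "((\<lambda>c. integral {0..c} (?\<Pi> (\<lambda>x. f (w x, S)))) has_vector_derivative ?\<Pi> (\<lambda>x. f (w x, S)) c) (at c within {0..1})"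
        by (intro integral_has_vector_derivative continuous_intros c)
      then have "((\<lambda>c. a + h *\<^sub>R I (\<lambda>x. f (w x, S)) c) has_vector_derivative h *\<^sub>R ?\<Pi> (\<lambda>x. f (w x, S)) c) (at c within {0..1})"
        unfolding I_def by (auto intro!: derivative_eq_intros)
      then show ?thesis
        by (rule has_vector_derivative_transform[OF c, rotated]) (rule wI)
    qed
    ultimately show ?thesis by blast
  qed
  then show ?thesis using h0 by blast
qed

section \<open>Passing between a step and the unit interval\<close>

lemma has_vector_derivative_rescale:
  fixes g :: "real \<Rightarrow> 'a::real_normed_vector"
  assumes "0 < h" "c \<in> {0..1}"
    and "(g has_vector_derivative g') (at (a + c * h) within {a..a + h})"
  shows "((\<lambda>c. g (a + c * h)) has_vector_derivative h *\<^sub>R g') (at c within {0..1})"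
proof -
  have "((\<lambda>c. a + c * h) has_vector_derivative h) (at c within {0..1})"
    by (auto intro!: derivative_eq_intros simp: has_real_derivative_iff_has_vector_derivative[symmetric])
  moreover have "(\<lambda>c. a + c * h) ` {0..1} \<subseteq> {a..a + h}"
    using assms(1) by (auto simp: mult_left_le_one_le)
  then have "(g has_vector_derivative g') (at (a + c * h) within (\<lambda>c. a + c * h) ` {0..1})"
    using assms(3) has_vector_derivative_within_subset by blast
  ultimately show ?thesis
    using vector_diff_chain_within[of "\<lambda>c. a + c * h" h c "{0..1}" g g'] by (simp add: o_def)
qed

lemma has_vector_derivative_unscale:
  fixes w :: "real \<Rightarrow> 'a::real_normed_vector"
  assumes "0 < h" "c \<in> {0..1}"
    and "(w has_vector_derivative h *\<^sub>R w') (at c within {0..1})"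
  shows "((\<lambda>t. w ((t - a) / h)) has_vector_derivative w') (at (a + c * h) within {a..a + h})"
proof -
  have "((\<lambda>t. (t - a) / h) has_vector_derivative 1 / h) (at (a + c * h) within {a..a + h})"
    using assms(1) by (auto intro!: derivative_eq_intros simp: has_real_derivative_iff_has_vector_derivative[symmetric])
  moreover have "(\<lambda>t. (t - a) / h) ` {a..a + h} \<subseteq> {0..1}"
    using assms(1) by (auto simp: divide_simps)
  then have "(w has_vector_derivative h *\<^sub>R w') (at ((a + c * h - a) / h) within (\<lambda>t. (t - a) / h) ` {a..a + h})"
    using assms(1,3) has_vector_derivative_within_subset by fastforce
  ultimately show ?thesis
    using vector_diff_chain_within[of "\<lambda>t. (t - a) / h" "1 / h" "a + c * h" "{a..a + h}" w "h *\<^sub>R w'"] assms(1)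
    by (simp add: o_def)
qed

text \<open>On \<open>[k, k + 1)\<close> the memory value is constant. Since \<open>y\<close> is continuous, it equals the integral of its
derivative up to and including \<open>k + 1\<close>, which yields the one-sided derivative there as well.\<close>
lemma EPCA_has_vector_derivative_closed:
  fixes f :: "(real^'m) \<times> (real^'m) \<Rightarrow> real^'m"
  assumes sol: "EPCA_solution f y0 K y" and f: "continuous_on UNIV f" and k: "k < K"
    and t: "t \<in> {real k..real k + 1}"
  shows "(y has_vector_derivative f (y t, y (real k))) (at t within {real k..real k + 1})"
proof -
  have cy: "continuous_on {real k..real k + 1} y"
    using sol k unfolding EPCA_solution_def by (auto elim!: continuous_on_subset)
  let ?g = "\<lambda>t. f (y t, y (real k))"
  have cg: "continuous_on {real k..real k + 1} ?g"
    by (rule continuous_on_compose2[OF f]) (auto intro!: continuous_intros cy)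
  have inner: "(y has_vector_derivative ?g x) (at x)" if x: "x \<in> {real k<..<real k + 1}" for x
  proof -
    have "\<lfloor>x\<rfloor> = int k" using x by (simp add: floor_eq_iff)
    moreover have "\<forall>t\<in>{real k..<real k + 1}. (y has_vector_derivative f (y t, y (of_int \<lfloor>t\<rfloor>)))
        (at t within {real k..<real k + 1})"
      using sol k unfolding EPCA_solution_def by blast
    from bspec[OF this, of x] have "(y has_vector_derivative f (y x, y (of_int \<lfloor>x\<rfloor>)))
        (at x within {real k..<real k + 1})"
      using x by auto
    ultimately have "(y has_vector_derivative ?g x) (at x within {real k..<real k + 1})" by simp
    then have "(y has_vector_derivative ?g x) (at x within {real k<..<real k + 1})"
      by (rule has_vector_derivative_within_subset) auto
    then show ?thesis
      using has_vector_derivative_within_open[OF x open_greaterThanLessThan, of y "?g x"] by blast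
  qed
  have eq: "y (real k) + integral {real k..x} ?g = y x" if x: "x \<in> {real k..real k + 1}" for x
  proof -
    have "(?g has_integral y x - y (real k)) {real k..x}"
      using x inner by (intro fundamental_theorem_of_calculus_interior continuous_on_subset[OF cy]) auto
    then show ?thesis by (simp add: integral_unique)
  qed
  have "((\<lambda>x. y (real k) + integral {real k..x} ?g) has_vector_derivative 0 + ?g t) (at t within {real k..real k + 1})"
    by (intro has_vector_derivative_add has_vector_derivative_const integral_has_vector_derivative cg t)
  then have "((\<lambda>x. y (real k) + integral {real k..x} ?g) has_vector_derivative ?g t) (at t within {real k..real k + 1})"
    by simp
  then show ?thesis by (rule has_vector_derivative_transform[OF t, rotated]) (simp add: eq)
qed

lemma pderiv_sum: "pderiv (\<Sum>x\<in>A. p x) = (\<Sum>x\<in>A. pderiv (p x))"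
  by (induction A rule: infinite_finite_induct) (simp_all add: pderiv_add)

lemma poly_antiderivative:
  fixes p :: "real poly"
  shows "\<exists>q. pderiv q = p \<and> poly q 0 = 0 \<and> degree q \<le> Suc (degree p)"
proof -
  define q where "q = (\<Sum>i\<le>degree p. monom (coeff p i / real (Suc i)) (Suc i))"
  have "pderiv q = (\<Sum>i\<le>degree p. monom (coeff p i) i)"
    by (simp add: q_def pderiv_sum pderiv_monom del: of_nat_Suc)
  then have "pderiv q = p" by (simp add: poly_as_sum_of_monoms)
  moreover have "poly q 0 = 0" by (simp add: q_def poly_sum poly_monom)
  moreover have "degree q \<le> Suc (degree p)" unfolding q_def
    by (intro degree_sum_le) (auto intro: order_trans[OF degree_monom_le])
  ultimately show ?thesis by blast
qed

text \<open>A function whose derivative is a combination of \<open>P 0, \<dots>, P (s - 1)\<close> differs by a constant from the same combination of their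
antiderivatives; in the original time variable this is composed with an affine map.\<close>
lemma legendre_proj_primitive_poly:
  fixes w :: "real \<Rightarrow> real^'m"
  assumes P: "orthonormal_legendre P" and h: "0 < h"
    and w: "\<And>c. c \<in> {0..1} \<Longrightarrow> (w has_vector_derivative h *\<^sub>R legendre_proj P s g c) (at c within {0..1})"
  shows "\<exists>q :: 'm \<Rightarrow> real poly. (\<forall>i. degree (q i) \<le> s) \<and> (\<forall>t\<in>{a..a + h}. w ((t - a) / h) = (\<chi> i. poly (q i) t))"
proof -
  define \<gamma> where "\<gamma> j = integral {0..1} (\<lambda>x. poly (P j) x *\<^sub>R g x)" for j
  have "\<forall>j. \<exists>q. pderiv q = P j \<and> poly q 0 = 0 \<and> degree q \<le> Suc (degree (P j))"
    using poly_antiderivative by blast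
  from choice[OF this] obtain Q where Q: "\<forall>j. pderiv (Q j) = P j \<and> poly (Q j) 0 = 0 \<and> degree (Q j) \<le> Suc (degree (P j))" ..
  have dQ: "degree (Q j) \<le> s" if "j < s" for j
    using Q[rule_format, of j] P that by (simp add: orthonormal_legendre_def)
  have wc: "w c = w 0 + h *\<^sub>R (\<Sum>j<s. poly (Q j) c *\<^sub>R \<gamma> j)" if c: "c \<in> {0..1}" for c
  proof -
    define D where "D c = w c - h *\<^sub>R (\<Sum>j<s. poly (Q j) c *\<^sub>R \<gamma> j)" for c
    have "(D has_vector_derivative 0) (at x within {0..1})" if x: "x \<in> {0..1}" for x
    proof -
      have "((\<lambda>c. poly (Q j) c *\<^sub>R \<gamma> j) has_vector_derivative poly (P j) x *\<^sub>R \<gamma> j) (at x within {0..1})" for j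
        using has_vector_derivative_scaleR[OF has_field_derivative_at_within[OF poly_DERIV[of "Q j" x]]
            has_vector_derivative_const[of "\<gamma> j"]] Q by simp
      then have "(D has_vector_derivative h *\<^sub>R legendre_proj P s g x - h *\<^sub>R (\<Sum>j<s. poly (P j) x *\<^sub>R \<gamma> j)) (at x within {0..1})"
        unfolding D_def
        by (intro has_vector_derivative_diff w x has_vector_derivative_sum
            bounded_linear.has_vector_derivative[OF bounded_linear_scaleR_right])
      then show ?thesis by (simp add: legendre_proj_def \<gamma>_def)
    qed
    then have "D c = D 0"
      using c unfolding has_vector_derivative_def
      by (intro has_derivative_zero_unique[of "{0..1}" D]) auto
    then show ?thesis using Q by (simp add: D_def algebra_simps)
  qed
  define q where "q i = [:w 0 $ i:] + smult h (\<Sum>j<s. smult (\<gamma> j $ i) (Q j))" for i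
  define l where "l = [:- a / h, 1 / h:]"
  have "degree (q i) \<le> s" for i
    unfolding q_def using dQ
    by (intro degree_add_le degree_sum_le order_trans[OF degree_smult_le]) auto
  then have "degree (pcompose (q i) l) \<le> s" for i
    using degree_pcompose_le[of "q i" l] by (auto simp: l_def intro: order_trans)
  moreover have "w ((t - a) / h) = (\<chi> i. poly (pcompose (q i) l) t)" if t: "t \<in> {a..a + h}" for t
  proof -
    have "(t - a) / h \<in> {0..1}" using t h by (auto simp: divide_simps)
    from wc[OF this] have "w ((t - a) / h) = w 0 + h *\<^sub>R (\<Sum>j<s. poly (Q j) ((t - a) / h) *\<^sub>R \<gamma> j)" .
    moreover have "poly l t = (t - a) / h" by (simp add: l_def diff_divide_distrib)
    ultimately show ?thesis
      by (simp add: vec_eq_iff poly_pcompose q_def poly_sum mult_ac)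
  qed
  ultimately show ?thesis by (intro exI[of _ "\<lambda>i. pcompose (q i) l"]) auto
qed

section \<open>Accumulation of errors over all steps\<close>

text \<open>The extra index \<open>m\<close> is that of the memory value. The bound is increasing in \<open>n\<close>, so a delayed term
costs no more than a current one, hence the factor 2.\<close>
lemma discrete_gronwall:
  fixes a :: "nat \<Rightarrow> real" and C \<delta> :: real
  assumes "a 0 = 0" "0 \<le> C" "0 \<le> \<delta>"
    and "\<And>n. n < N \<Longrightarrow> \<exists>m\<le>n. a (Suc n) \<le> a n + C * (a n + a m + \<delta>)"
    and "n \<le> N"
  shows "a n \<le> ((1 + 2 * C) ^ n - 1) * \<delta>"
  using assms(5)
proof (induction n rule: less_induct)
  case (less n)
  show ?case
  proof (cases n)
    case 0
    then show ?thesis using assms(1) by simp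
  next
    case (Suc k)
    let ?b = "\<lambda>n. ((1 + 2 * C) ^ n - 1) * \<delta>"
    obtain m where m: "m \<le> k" "a (Suc k) \<le> a k + C * (a k + a m + \<delta>)"
      using assms(4)[of k] less.prems Suc by auto
    have ak: "a k \<le> ?b k" using less Suc by simp
    have "a m \<le> ?b m" using less Suc m by simp
    also have "\<dots> \<le> ?b k"
      using m assms by (intro mult_right_mono diff_right_mono power_increasing) auto
    finally have am: "a m \<le> ?b k" .
    have "a (Suc k) \<le> ?b k + C * (?b k + ?b k + \<delta>)"
      using m(2) ak am mult_left_mono[OF add_mono[OF add_mono[OF ak am] order_refl[of \<delta>]] assms(2)] by linarith
    also have "\<dots> \<le> ?b (Suc k)" using assms(2,3) by (simp add: algebra_simps)
    finally show ?thesis using Suc by simp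
  qed
qed

lemma power_one_plus_le_exp:
  fixes x :: real
  assumes "0 \<le> x"
  shows "(1 + x) ^ n \<le> exp (real n * x)"
proof -
  have "(1 + x) ^ n \<le> exp x ^ n" using assms exp_ge_add_one_self[of x] by (intro power_mono) auto
  then show ?thesis by (simp add: exp_of_nat_mult)
qed

text \<open>The defining conditions on the piecewise polynomial approximation for one step, and then for the first \<open>N\<close> steps, so that
approximations can be built and estimated step by step.\<close>
definition approx_piece ::
  "((real^'m) \<times> (real^'m) \<Rightarrow> real^'m) \<Rightarrow> (nat \<Rightarrow> real poly) \<Rightarrow> nat \<Rightarrow> nat \<Rightarrow> nat \<Rightarrow> (real \<Rightarrow> real^'m) \<Rightarrow> bool" where
  "approx_piece f P s \<nu> n \<tau> \<longleftrightarrow>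
     (\<exists>q :: 'm \<Rightarrow> real poly. (\<forall>i. degree (q i) \<le> s) \<and>
        (\<forall>t\<in>{grid \<nu> (n - 1)..grid \<nu> n}. \<tau> t = (\<chi> i. poly (q i) t))) \<and>
     (\<forall>c\<in>{0..1}. (\<tau> has_vector_derivative (\<Sum>j<s. poly (P j) c *\<^sub>R gam f P \<nu> \<tau> n j))
          (at (grid \<nu> (n - 1) + c * step \<nu>) within {grid \<nu> (n - 1)..grid \<nu> n}))"

definition approx_upto ::
  "((real^'m) \<times> (real^'m) \<Rightarrow> real^'m) \<Rightarrow> real^'m \<Rightarrow> (nat \<Rightarrow> real poly) \<Rightarrow> nat \<Rightarrow> nat \<Rightarrow> nat \<Rightarrow> (real \<Rightarrow> real^'m) \<Rightarrow> bool" where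
  "approx_upto f y0 P s \<nu> N \<tau> \<longleftrightarrow> \<tau> 0 = y0 \<and> (\<forall>n<N. approx_piece f P s \<nu> (Suc n) \<tau>)"

lemma poly_approx_iff: "poly_approx f y0 K P s \<nu> \<tau> \<longleftrightarrow> approx_upto f y0 P s \<nu> (K * \<nu>) \<tau>"
proof -
  have "(\<forall>n\<in>{1..N}. Q n) \<longleftrightarrow> (\<forall>n<N. Q (Suc n))" for N and Q :: "nat \<Rightarrow> bool"
    by (metis One_nat_def Suc_le_D Suc_le_eq Suc_le_lessD atLeastAtMost_iff le0 not_less_eq_eq)
  then show ?thesis
    unfolding poly_approx_def approx_upto_def approx_piece_def by presburger
qed

lemma step_pos: "0 < \<nu> \<Longrightarrow> 0 < step \<nu>"
  by (simp add: step_def)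

lemma step_le_1: "step \<nu> \<le> 1"
  by (cases "\<nu> = 0") (simp_all add: step_def divide_le_eq)

lemma grid_0: "grid \<nu> 0 = 0"
  by (simp add: grid_def)

lemma grid_Suc: "grid \<nu> (Suc n) = grid \<nu> n + step \<nu>"
  by (simp add: grid_def algebra_simps)

lemma grid_mono: "m \<le> n \<Longrightarrow> grid \<nu> m \<le> grid \<nu> n"
  by (simp add: grid_def step_def divide_right_mono)

lemma grid_mult: "0 < \<nu> \<Longrightarrow> grid \<nu> (k * \<nu>) = real k"
  by (simp add: grid_def step_def)

lemma grid_in_unit_interval:
  assumes "0 < \<nu>"
  shows "real (n div \<nu>) \<le> grid \<nu> n" "grid \<nu> (Suc n) \<le> real (n div \<nu>) + 1"
proof -
  show "real (n div \<nu>) \<le> grid \<nu> n"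
    unfolding grid_mult[OF assms, symmetric] by (intro grid_mono) simp
  have "Suc n \<le> Suc (n div \<nu>) * \<nu>" using assms by (metis Suc_leI dividend_less_div_times mult_Suc add.commute)
  from grid_mono[OF this, of \<nu>] show "grid \<nu> (Suc n) \<le> real (n div \<nu>) + 1"
    unfolding grid_mult[OF assms] by simp
qed

lemma gam_eq:
  "gam f P \<nu> \<tau> (Suc n) j =
    integral {0..1} (\<lambda>c. poly (P j) c *\<^sub>R f (\<tau> (grid \<nu> n + c * step \<nu>), \<tau> (real (n div \<nu>))))"
  by (simp add: gam_def floor_divide_of_nat_eq)

lemma sum_gam_eq_legendre_proj:
  "(\<Sum>j<s. poly (P j) c *\<^sub>R gam f P \<nu> \<tau> (Suc n) j) =
    legendre_proj P s (\<lambda>x. f (\<tau> (grid \<nu> n + x * step \<nu>), \<tau> (real (n div \<nu>)))) c"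
  by (simp add: legendre_proj_def gam_eq)

lemma step_pair_of_piece:
  fixes f :: "(real^'m) \<times> (real^'m) \<Rightarrow> real^'m"
  assumes sol: "EPCA_solution f y0 K y" and f: "continuous_on UNIV f" and \<nu>: "0 < \<nu>" and n: "n < K * \<nu>"
    and piece: "approx_piece f P s \<nu> (Suc n) \<tau>"
    and yR: "\<And>t. t \<in> {0..real K} \<Longrightarrow> norm (y t) \<le> R"
    and \<tau>R: "\<And>t. t \<in> {0..grid \<nu> (Suc n)} \<Longrightarrow> norm (\<tau> t) \<le> R"
  shows "step_pair f P s R (step \<nu>) (\<lambda>c. y (grid \<nu> n + c * step \<nu>)) (\<lambda>c. \<tau> (grid \<nu> n + c * step \<nu>))
    (y (real (n div \<nu>))) (\<tau> (real (n div \<nu>)))"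
proof -
  let ?k = "n div \<nu>"
  have h: "0 < step \<nu>" using \<nu> by (rule step_pos)
  have k: "?k < K" using n \<nu> by (simp add: div_less_iff_less_mult)
  note unit = grid_in_unit_interval[OF \<nu>, of n]
  have tc: "grid \<nu> n + c * step \<nu> \<in> {grid \<nu> n..grid \<nu> (Suc n)}" if "c \<in> {0..1}" for c
    using that h by (auto simp: grid_Suc mult_left_le_one_le)
  have g0: "0 \<le> grid \<nu> n" using grid_mono[of 0 n \<nu>] by (simp add: grid_0)
  have gK: "grid \<nu> (Suc n) \<le> real K"
    using grid_mono[of "Suc n" "K * \<nu>" \<nu>] n grid_mult[OF \<nu>, of K] by simp
  have sub: "{grid \<nu> n..grid \<nu> n + step \<nu>} \<subseteq> {real ?k..real ?k + 1}"
    using unit by (auto simp: grid_Suc)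
  show ?thesis unfolding step_pair_def
  proof (intro conjI ballI)
    show "(\<lambda>c. y (grid \<nu> n + c * step \<nu>)) ` {0..1} \<subseteq> cball 0 R"
      using yR tc g0 gK by fastforce
    show "(\<lambda>c. \<tau> (grid \<nu> n + c * step \<nu>)) ` {0..1} \<subseteq> cball 0 R"
      using \<tau>R tc g0 by fastforce
    show "y (real ?k) \<in> cball 0 R" using yR[of "real ?k"] k by simp
    show "\<tau> (real ?k) \<in> cball 0 R"
      using \<tau>R[of "real ?k"] unit(1) h by (simp add: grid_Suc)
    fix c :: real assume c: "c \<in> {0..1}"
    have "(y has_vector_derivative f (y (grid \<nu> n + c * step \<nu>), y (real ?k)))
        (at (grid \<nu> n + c * step \<nu>) within {real ?k..real ?k + 1})"
      by (rule EPCA_has_vector_derivative_closed[OF sol f k]) (use tc[OF c] sub in \<open>auto simp: grid_Suc\<close>)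
    then show "((\<lambda>c. y (grid \<nu> n + c * step \<nu>)) has_vector_derivative
        step \<nu> *\<^sub>R f (y (grid \<nu> n + c * step \<nu>), y (real ?k))) (at c within {0..1})"
      by (intro has_vector_derivative_rescale h c has_vector_derivative_within_subset[OF _ sub])
    have "(\<tau> has_vector_derivative (\<Sum>j<s. poly (P j) c *\<^sub>R gam f P \<nu> \<tau> (Suc n) j))
        (at (grid \<nu> n + c * step \<nu>) within {grid \<nu> n..grid \<nu> n + step \<nu>})"
      using piece c unfolding approx_piece_def by (simp add: grid_Suc)
    then show "((\<lambda>c. \<tau> (grid \<nu> n + c * step \<nu>)) has_vector_derivative step \<nu> *\<^sub>R
        legendre_proj P s (\<lambda>x. f (\<tau> (grid \<nu> n + x * step \<nu>), \<tau> (real ?k))) c) (at c within {0..1})"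
      unfolding sum_gam_eq_legendre_proj by (intro has_vector_derivative_rescale h c)
  qed (rule h)
qed

definition error_bounded :: "real \<Rightarrow> nat \<Rightarrow> nat \<Rightarrow> nat \<Rightarrow> (real \<Rightarrow> real^'m) \<Rightarrow> (real \<Rightarrow> real^'m) \<Rightarrow> bool" where
  "error_bounded C s \<nu> N y \<tau> \<longleftrightarrow>
      (\<forall>n\<le>N. norm (y (grid \<nu> n) - \<tau> (grid \<nu> n)) \<le> C * step \<nu> ^ (2 * s)) \<and>
      (\<forall>n<N. norm ((y (grid \<nu> (Suc n)) - \<tau> (grid \<nu> (Suc n))) - (y (grid \<nu> n) - \<tau> (grid \<nu> n))) \<le> C * step \<nu> ^ (2 * s + 1)) \<and>
      (\<forall>n<N. \<forall>c\<in>{0..1}. norm (y (grid \<nu> n + c * step \<nu>) - \<tau> (grid \<nu> n + c * step \<nu>)) \<le> C * step \<nu> ^ (s + 1))"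

text \<open>Any approximation that stays in a fixed ball obeys the error bounds, with constants independent of the
number of steps, the step size and the approximation. The one-step estimate is a recursion for the nodal errors, whose inherited part is the previous nodal error plus the error at
the last integer node. Gronwall's inequality gives nodal errors of order \<open>h ^ (2 * s)\<close>; inserting them into the one-step estimates
gives the other two bounds, since \<open>s + 1 \<le> 2 * s\<close>.\<close>
lemma approx_error_bounds:
  fixes f :: "(real^'m) \<times> (real^'m) \<Rightarrow> real^'m"
  assumes f: "C_inf f" and s: "0 < s" and P: "orthonormal_legendre P" and sol: "EPCA_solution f y0 K y"
    and yR: "\<And>t. t \<in> {0..real K} \<Longrightarrow> norm (y t) \<le> R"
  shows "\<exists>C\<ge>0. \<exists>h0>0. \<forall>\<nu> N \<tau>. 0 < \<nu> \<and> step \<nu> \<le> h0 \<and> N \<le> K * \<nu> \<and> approx_upto f y0 P s \<nu> N \<tau> \<and>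
      (\<forall>t\<in>{0..grid \<nu> N}. norm (\<tau> t) \<le> R) \<longrightarrow>
      error_bounded C s \<nu> N y \<tau>"
proof -
  obtain C0 h0 where C0: "C0 \<ge> 0" and h0: "h0 > 0" and one:
    "\<And>h u w Y S. h \<le> h0 \<Longrightarrow> step_pair f P s R h u w Y S \<Longrightarrow>
      norm ((u 1 - w 1) - (u 0 - w 0)) \<le> C0 * h * (norm (u 0 - w 0) + norm (Y - S) + h ^ (2 * s)) \<and>
      (\<forall>c\<in>{0..1}. norm (u c - w c) \<le> C0 * (norm (u 0 - w 0) + norm (Y - S) + h ^ (s + 1)))"
    using one_step_error[OF f P s, of R] by blast
  define G where "G = exp (2 * C0 * real K)"
  have G: "G \<ge> 1" using C0 by (simp add: G_def)
  define C where "C = G + C0 * (2 * G + 1)"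
  have C: "0 \<le> C" "G \<le> C" "C0 * (2 * G + 1) \<le> C" using G C0 by (auto simp: C_def)
  have "error_bounded C s \<nu> N y \<tau>"
    if \<nu>: "0 < \<nu>" "step \<nu> \<le> h0" and N: "N \<le> K * \<nu>" and \<tau>: "approx_upto f y0 P s \<nu> N \<tau>"
      and \<tau>R: "\<forall>t\<in>{0..grid \<nu> N}. norm (\<tau> t) \<le> R" for \<nu> N \<tau>
  proof -
    define h where "h = step \<nu>"
    have h: "0 < h" "h \<le> 1" using step_pos[OF \<nu>(1)] step_le_1 by (auto simp: h_def)
    define e where "e t = y t - \<tau> t" for t
    define a where "a n = norm (e (grid \<nu> n))" for n
    have step: "norm (e (grid \<nu> (Suc n)) - e (grid \<nu> n)) \<le> C0 * h * (a n + a (n div \<nu> * \<nu>) + h ^ (2 * s))"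
      "c \<in> {0..1} \<Longrightarrow> norm (e (grid \<nu> n + c * h)) \<le> C0 * (a n + a (n div \<nu> * \<nu>) + h ^ (s + 1))"
      if n: "n < N" for n c
    proof -
      have "step_pair f P s R (step \<nu>) (\<lambda>c. y (grid \<nu> n + c * step \<nu>)) (\<lambda>c. \<tau> (grid \<nu> n + c * step \<nu>))
          (y (real (n div \<nu>))) (\<tau> (real (n div \<nu>)))"
      proof (rule step_pair_of_piece[OF sol C_inf_continuous[OF f] \<nu>(1) _ _ yR])
        show "n < K * \<nu>" using n N by simp
        show "approx_piece f P s \<nu> (Suc n) \<tau>" using \<tau> n by (simp add: approx_upto_def)
        show "norm (\<tau> t) \<le> R" if "t \<in> {0..grid \<nu> (Suc n)}" for t
          using that \<tau>R grid_mono[of "Suc n" N \<nu>] n by auto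
      qed
      from one[OF \<nu>(2) this] show "norm (e (grid \<nu> (Suc n)) - e (grid \<nu> n)) \<le> C0 * h * (a n + a (n div \<nu> * \<nu>) + h ^ (2 * s))"
        "c \<in> {0..1} \<Longrightarrow> norm (e (grid \<nu> n + c * h)) \<le> C0 * (a n + a (n div \<nu> * \<nu>) + h ^ (s + 1))"
        by (simp_all add: e_def a_def h_def grid_Suc grid_mult[OF \<nu>(1)])
    qed
    have node: "a n \<le> G * h ^ (2 * s)" if n: "n \<le> N" for n
    proof -
      have "a n \<le> ((1 + 2 * (C0 * h)) ^ n - 1) * h ^ (2 * s)"
      proof (rule discrete_gronwall[OF _ _ _ _ n])
        show "a 0 = 0" using \<tau> sol by (simp add: a_def e_def grid_0 approx_upto_def EPCA_solution_def)
        show "\<exists>m\<le>n. a (Suc n) \<le> a n + C0 * h * (a n + a m + h ^ (2 * s))" if "n < N" for n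
        proof (intro exI conjI)
          show "n div \<nu> * \<nu> \<le> n" by simp
          show "a (Suc n) \<le> a n + C0 * h * (a n + a (n div \<nu> * \<nu>) + h ^ (2 * s))"
            using step(1)[OF that] norm_triangle_sub[of "e (grid \<nu> (Suc n))" "e (grid \<nu> n)"]
            by (simp add: a_def)
        qed
      qed (use C0 h in auto)
      also have "\<dots> \<le> G * h ^ (2 * s)"
      proof (rule mult_right_mono)
        have "(1 + 2 * (C0 * h)) ^ n \<le> exp (real n * (2 * (C0 * h)))"
          using C0 h by (intro power_one_plus_le_exp) auto
        also have "\<dots> \<le> G"
        proof -
          have "grid \<nu> n \<le> real K" using grid_mono[of n "K * \<nu>" \<nu>] n N grid_mult[OF \<nu>(1), of K] by simp
          then have "real n * h \<le> real K" by (simp add: grid_def h_def)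
          then have "2 * C0 * (real n * h) \<le> 2 * C0 * real K" using C0 by (intro mult_left_mono) auto
          then show ?thesis by (simp add: G_def mult_ac)
        qed
        finally show "(1 + 2 * (C0 * h)) ^ n - 1 \<le> G" by simp
      qed (use h in auto)
      finally show ?thesis .
    qed
    have mem: "a n + a (n div \<nu> * \<nu>) \<le> 2 * G * h ^ (2 * s)" if "n < N" for n
      using node[of n] node[of "n div \<nu> * \<nu>"] that by (simp add: order_trans[OF div_times_less_eq_dividend])
    have "norm (e (grid \<nu> n)) \<le> C * h ^ (2 * s)" if "n \<le> N" for n
      using order_trans[OF node[OF that] mult_right_mono[OF C(2)]] h by (simp add: a_def)
    moreover have "norm (e (grid \<nu> (Suc n)) - e (grid \<nu> n)) \<le> C * h ^ (2 * s + 1)" if "n < N" for n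
    proof -
      have "norm (e (grid \<nu> (Suc n)) - e (grid \<nu> n)) \<le> C0 * h * (2 * G * h ^ (2 * s) + h ^ (2 * s))"
        using C0 h mem[OF that] by (intro order_trans[OF step(1)[OF that]] mult_left_mono) auto
      also have "\<dots> = C0 * (2 * G + 1) * h ^ (2 * s + 1)" by (simp add: algebra_simps)
      also have "\<dots> \<le> C * h ^ (2 * s + 1)" using C h by (intro mult_right_mono) auto
      finally show ?thesis .
    qed
    moreover have "norm (e (grid \<nu> n + c * h)) \<le> C * h ^ (s + 1)" if "n < N" "c \<in> {0..1}" for n c
    proof -
      have "h ^ (2 * s) \<le> h ^ (s + 1)" using h s by (intro power_decreasing) auto
      then have "2 * G * h ^ (2 * s) \<le> 2 * G * h ^ (s + 1)" using G by (intro mult_left_mono) auto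
      then have "a n + a (n div \<nu> * \<nu>) + h ^ (s + 1) \<le> (2 * G + 1) * h ^ (s + 1)"
        using mem[OF that(1)] by (simp add: algebra_simps)
      then have "norm (e (grid \<nu> n + c * h)) \<le> C0 * ((2 * G + 1) * h ^ (s + 1))"
        using C0 by (intro order_trans[OF step(2)[OF that]] mult_left_mono) auto
      also have "\<dots> = C0 * (2 * G + 1) * h ^ (s + 1)" by simp
      also have "\<dots> \<le> C * h ^ (s + 1)" using C h by (intro mult_right_mono) auto
      finally show ?thesis .
    qed
    ultimately show ?thesis unfolding error_bounded_def e_def h_def by blast
  qed
  then show ?thesis using C(1) h0 by blast
qed

text \<open>The old pieces are not disturbed, because their conditions involve only values up to their right end.\<close>
lemma approx_upto_extend:
  fixes f :: "(real^'m) \<times> (real^'m) \<Rightarrow> real^'m"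
  assumes \<nu>: "0 < \<nu>" and P: "orthonormal_legendre P" and \<tau>: "approx_upto f y0 P s \<nu> N \<tau>"
    and w0: "w 0 = \<tau> (grid \<nu> N)"
    and w: "\<And>c. c \<in> {0..1} \<Longrightarrow> (w has_vector_derivative
        step \<nu> *\<^sub>R legendre_proj P s (\<lambda>x. f (w x, \<tau> (real (N div \<nu>)))) c) (at c within {0..1})"
  shows "approx_upto f y0 P s \<nu> (Suc N) (\<lambda>t. if t \<le> grid \<nu> N then \<tau> t else w ((t - grid \<nu> N) / step \<nu>))"
proof -
  define \<tau>' where "\<tau>' t = (if t \<le> grid \<nu> N then \<tau> t else w ((t - grid \<nu> N) / step \<nu>))" for t
  have h: "0 < step \<nu>" using \<nu> by (rule step_pos)
  have old: "\<tau>' t = \<tau> t" if "t \<le> grid \<nu> N" for t using that by (simp add: \<tau>'_def)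
  have new: "\<tau>' t = w ((t - grid \<nu> N) / step \<nu>)" if "grid \<nu> N \<le> t" for t
    using that w0 by (cases "t = grid \<nu> N") (auto simp: \<tau>'_def)
  have tc: "grid \<nu> n + c * step \<nu> \<in> {grid \<nu> n..grid \<nu> (Suc n)}" if "c \<in> {0..1}" for c n
    using that h by (auto simp: grid_Suc mult_left_le_one_le)
  have mem: "\<tau>' (real (n div \<nu>)) = \<tau> (real (n div \<nu>))" if "n \<le> N" for n
    using grid_in_unit_interval(1)[OF \<nu>, of n] grid_mono[OF that, of \<nu>] by (intro old) simp
  have "approx_piece f P s \<nu> (Suc n) \<tau>'" if n: "n < Suc N" for n
  proof (cases "n < N")
    case True
    then have le: "grid \<nu> (Suc n) \<le> grid \<nu> N" by (intro grid_mono) simp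
    have "gam f P \<nu> \<tau>' (Suc n) j = gam f P \<nu> \<tau> (Suc n) j" for j
      unfolding gam_eq using n le tc[of _ n] by (intro integral_cong) (simp add: old mem order_trans[OF _ le])
    moreover have "(\<tau>' has_vector_derivative d) (at t within {grid \<nu> n..grid \<nu> (Suc n)})"
      if "(\<tau> has_vector_derivative d) (at t within {grid \<nu> n..grid \<nu> (Suc n)})" "t \<in> {grid \<nu> n..grid \<nu> (Suc n)}" for d t
      by (rule has_vector_derivative_transform[OF that(2) _ that(1)]) (use le old in auto)
    moreover have "approx_piece f P s \<nu> (Suc n) \<tau>" using \<tau> True by (simp add: approx_upto_def)
    moreover have "\<tau>' t = \<tau> t" if "t \<in> {grid \<nu> n..grid \<nu> (Suc n)}" for t using that le old by auto
    ultimately show ?thesis unfolding approx_piece_def diff_Suc_1 using tc[of _ n] by simp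
  next
    case False
    then have nN: "n = N" using n by simp
    have wc: "\<tau>' (grid \<nu> N + c * step \<nu>) = w c" if "c \<in> {0..1}" for c
      using that h by (subst new) auto
    have gam: "(\<Sum>j<s. poly (P j) c *\<^sub>R gam f P \<nu> \<tau>' (Suc N) j)
        = legendre_proj P s (\<lambda>x. f (w x, \<tau> (real (N div \<nu>)))) c" for c
    proof -
      have "gam f P \<nu> \<tau>' (Suc N) j = integral {0..1} (\<lambda>c. poly (P j) c *\<^sub>R f (w c, \<tau> (real (N div \<nu>))))" for j
        unfolding gam_eq by (intro integral_cong) (simp add: wc mem)
      then show ?thesis by (simp add: legendre_proj_def)
    qed
    have "(\<tau>' has_vector_derivative (\<Sum>j<s. poly (P j) c *\<^sub>R gam f P \<nu> \<tau>' (Suc N) j))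
        (at (grid \<nu> N + c * step \<nu>) within {grid \<nu> N..grid \<nu> N + step \<nu>})" if c: "c \<in> {0..1}" for c
      unfolding gam
      by (rule has_vector_derivative_transform[OF _ _ has_vector_derivative_unscale[OF h c w[OF c]]])
        (use tc[OF c, of N] new in \<open>auto simp: grid_Suc\<close>)
    moreover have "\<exists>q :: 'm \<Rightarrow> real poly. (\<forall>i. degree (q i) \<le> s) \<and>
        (\<forall>t\<in>{grid \<nu> N..grid \<nu> N + step \<nu>}. \<tau>' t = (\<chi> i. poly (q i) t))"
      using legendre_proj_primitive_poly[OF P h w, of "grid \<nu> N"] new by auto
    ultimately show ?thesis unfolding approx_piece_def nN diff_Suc_1 grid_Suc by blast
  qed
  moreover have "\<tau>' 0 = y0"
    using \<tau> old[of 0] grid_mono[of 0 N \<nu>] by (simp add: grid_0 approx_upto_def)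
  ultimately have "approx_upto f y0 P s \<nu> (Suc N) \<tau>'" by (simp add: approx_upto_def)
  moreover have "\<tau>' = (\<lambda>t. if t \<le> grid \<nu> N then \<tau> t else w ((t - grid \<nu> N) / step \<nu>))"
    by (simp add: fun_eq_iff \<tau>'_def)
  ultimately show ?thesis by simp
qed

lemma step_tendsto_0: "step \<longlonglongrightarrow> 0"
  unfolding step_def by (rule lim_inverse_n'[unfolded inverse_eq_divide])

lemma eventually_step_le:
  assumes "0 < r"
  shows "\<forall>\<^sub>F \<nu> in sequentially. 0 < \<nu> \<and> step \<nu> \<le> r"
  using order_tendstoD(2)[OF step_tendsto_0 assms] eventually_gt_at_top[of 0]
  by eventually_elim auto

text \<open>Approximations are continued one step at a time. The ball of radius \<open>R + 2\<close> is never left: the error bounds keep the nodal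
values within distance 1 of the exact ones, and within a step the new piece moves by at most 1.\<close>
lemma approx_in_tube_exists:
  fixes f :: "(real^'m) \<times> (real^'m) \<Rightarrow> real^'m"
  assumes f: "C_inf f" and s: "0 < s" and P: "orthonormal_legendre P" and sol: "EPCA_solution f y0 K y"
    and yR: "\<And>t. t \<in> {0..real K} \<Longrightarrow> norm (y t) \<le> R"
  shows "\<forall>\<^sub>F \<nu> in sequentially. \<exists>\<tau>. poly_approx f y0 K P s \<nu> \<tau> \<and> (\<forall>t\<in>{0..real K}. norm (\<tau> t) \<le> R + 2)"
proof -
  have yR2: "norm (y t) \<le> R + 2" if "t \<in> {0..real K}" for t using yR[OF that] by simp
  obtain C h0 where C: "C \<ge> 0" and h0: "h0 > 0" and err: "\<And>\<nu> N \<tau>. 0 < \<nu> \<Longrightarrow> step \<nu> \<le> h0 \<Longrightarrow> N \<le> K * \<nu> \<Longrightarrow>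
      approx_upto f y0 P s \<nu> N \<tau> \<Longrightarrow> (\<forall>t\<in>{0..grid \<nu> N}. norm (\<tau> t) \<le> R + 2) \<Longrightarrow> error_bounded C s \<nu> N y \<tau>"
    using approx_error_bounds[OF f s P sol yR2] by blast
  obtain h1 where h1: "h1 > 0" and ex: "\<And>h a S. 0 < h \<Longrightarrow> h \<le> h1 \<Longrightarrow> a \<in> cball 0 (R + 1) \<Longrightarrow> S \<in> cball 0 (R + 1) \<Longrightarrow>
      (\<exists>w. w 0 = a \<and> w ` {0..1} \<subseteq> cball 0 (R + 1 + 1) \<and>
        (\<forall>c\<in>{0..1}. (w has_vector_derivative h *\<^sub>R legendre_proj P s (\<lambda>x. f (w x, S)) c) (at c within {0..1})))"
    using legendre_step_exists[OF f, of "R + 1" P s] by blast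
  \<comment> \<open>The last bound makes \<open>C * h ^ (2 * s) \<le> 1\<close>.\<close>
  define r where "r = min (min h0 h1) (1 / (C + 1))"
  have r: "0 < r" "r \<le> h0" "r \<le> h1" "r \<le> 1 / (C + 1)" using h0 h1 C by (auto simp: r_def)
  have upto: "\<exists>\<tau>. approx_upto f y0 P s \<nu> N \<tau> \<and> (\<forall>t\<in>{0..grid \<nu> N}. norm (\<tau> t) \<le> R + 2)"
    if \<nu>: "0 < \<nu>" "step \<nu> \<le> r" and N: "N \<le> K * \<nu>" for \<nu> N
    using N
  proof (induction N)
    case 0
    have "norm y0 \<le> R" using yR[of 0] sol by (simp add: EPCA_solution_def)
    then show ?case by (intro exI[of _ "\<lambda>_. y0"]) (auto simp: approx_upto_def grid_0)
  next
    case (Suc N)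
    then obtain \<tau> where \<tau>: "approx_upto f y0 P s \<nu> N \<tau>" and \<tau>R: "\<forall>t\<in>{0..grid \<nu> N}. norm (\<tau> t) \<le> R + 2"
      by auto
    have h: "0 < step \<nu>" using \<nu> by (intro step_pos)
    have small: "C * step \<nu> ^ (2 * s) \<le> 1"
    proof -
      have "step \<nu> ^ (2 * s) \<le> step \<nu> ^ 1" using h s step_le_1 by (intro power_decreasing) auto
      also have "\<dots> \<le> 1 / (C + 1)" using \<nu> r by simp
      finally have "C * step \<nu> ^ (2 * s) \<le> C * (1 / (C + 1))" using C by (intro mult_left_mono)
      also have "\<dots> \<le> 1" using C by (simp add: divide_le_eq)
      finally show ?thesis .
    qed
    have node: "\<tau> (grid \<nu> n) \<in> cball 0 (R + 1)" if n: "n \<le> N" for n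
    proof -
      have "norm (y (grid \<nu> n) - \<tau> (grid \<nu> n)) \<le> 1"
        using err[OF \<nu>(1) _ _ \<tau> \<tau>R] \<nu> r Suc.prems small n unfolding error_bounded_def by fastforce
      moreover have "norm (y (grid \<nu> n)) \<le> R"
        using grid_mono[of n "K * \<nu>" \<nu>] grid_mono[of 0 n \<nu>] n Suc.prems grid_mult[OF \<nu>(1), of K]
        by (intro yR) (auto simp: grid_0)
      ultimately show ?thesis
        using norm_triangle_sub[of "\<tau> (grid \<nu> n)" "y (grid \<nu> n)"] by (simp add: norm_minus_commute)
    qed
    have memo: "\<tau> (real (N div \<nu>)) \<in> cball 0 (R + 1)"
      using node[of "N div \<nu> * \<nu>"] by (simp add: grid_mult[OF \<nu>(1)])
    obtain w where w: "w 0 = \<tau> (grid \<nu> N)" "w ` {0..1} \<subseteq> cball 0 (R + 1 + 1)"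
      "\<forall>c\<in>{0..1}. (w has_vector_derivative step \<nu> *\<^sub>R legendre_proj P s (\<lambda>x. f (w x, \<tau> (real (N div \<nu>)))) c) (at c within {0..1})"
      using ex[OF h _ node[of N] memo] \<nu> r by auto
    let ?\<tau>' = "\<lambda>t. if t \<le> grid \<nu> N then \<tau> t else w ((t - grid \<nu> N) / step \<nu>)"
    have "approx_upto f y0 P s \<nu> (Suc N) ?\<tau>'"
      by (rule approx_upto_extend[OF \<nu>(1) P \<tau>, where w = w]) (use w in auto)
    moreover have "norm (?\<tau>' t) \<le> R + 2" if t: "t \<in> {0..grid \<nu> (Suc N)}" for t
    proof (cases "t \<le> grid \<nu> N")
      case True
      then show ?thesis using \<tau>R t by simp
    next
      case False
      then have "(t - grid \<nu> N) / step \<nu> \<in> {0..1}" using t h by (auto simp: grid_Suc divide_simps)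
      then have "w ((t - grid \<nu> N) / step \<nu>) \<in> cball 0 (R + 1 + 1)" using w(2) by blast
      then show ?thesis using False by simp
    qed
    ultimately show ?case by blast
  qed
  have "\<exists>\<tau>. poly_approx f y0 K P s \<nu> \<tau> \<and> (\<forall>t\<in>{0..real K}. norm (\<tau> t) \<le> R + 2)"
    if "0 < \<nu>" "step \<nu> \<le> r" for \<nu>
    unfolding poly_approx_iff using upto[OF that order_refl] unfolding grid_mult[OF that(1)] .
  then show ?thesis using eventually_step_le[OF r(1)] by (auto elim: eventually_mono)
qed

theorem theorem3:
  fixes f :: "(real^'m) \<times> (real^'m) \<Rightarrow> real^'m"
    and y0 :: "real^'m"
    and y :: "real \<Rightarrow> real^'m"
    and \<sigma> :: "nat \<Rightarrow> real \<Rightarrow> real^'m"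
    and P :: "nat \<Rightarrow> real poly"
    and K s :: nat
  assumes "C_inf f"
    and "K \<ge> 1"
    and "s \<ge> 1"
    and "orthonormal_legendre P"
    and "EPCA_solution f y0 K y"
    and "\<forall>\<^sub>F \<nu> in sequentially. unique_poly_approx f y0 K P s \<nu> (\<sigma> \<nu>)"
  shows "(\<exists>C. \<forall>\<^sub>F \<nu> in sequentially. \<forall>n\<in>{1..K * \<nu>}.
           norm ((y (grid \<nu> n) - \<sigma> \<nu> (grid \<nu> n))
                 - (y (grid \<nu> (n - 1)) - \<sigma> \<nu> (grid \<nu> (n - 1))))
             \<le> C * step \<nu> ^ (2 * s + 1)) \<and>
         (\<exists>C. \<forall>\<^sub>F \<nu> in sequentially. \<forall>n\<in>{1..K * \<nu>}. \<forall>c\<in>{0<..<1}.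
           norm (y (grid \<nu> (n - 1) + c * step \<nu>) - \<sigma> \<nu> (grid \<nu> (n - 1) + c * step \<nu>))
             \<le> C * step \<nu> ^ (s + 1))"
proof -
  have s: "0 < s" using assms(3) by simp
  have "bounded (y ` {0..real K})"
    using assms(5) unfolding EPCA_solution_def
    by (intro compact_imp_bounded compact_continuous_image) auto
  then obtain R where yR: "\<And>t. t \<in> {0..real K} \<Longrightarrow> norm (y t) \<le> R" unfolding bounded_iff by blast
  then have yR2: "norm (y t) \<le> R + 2" if "t \<in> {0..real K}" for t using that by fastforce
  obtain C h0 where h0: "h0 > 0" and err: "\<And>\<nu> N \<tau>. 0 < \<nu> \<Longrightarrow> step \<nu> \<le> h0 \<Longrightarrow> N \<le> K * \<nu> \<Longrightarrow>
      approx_upto f y0 P s \<nu> N \<tau> \<Longrightarrow> (\<forall>t\<in>{0..grid \<nu> N}. norm (\<tau> t) \<le> R + 2) \<Longrightarrow>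
      error_bounded C s \<nu> N y \<tau>"
    using approx_error_bounds[OF assms(1) s assms(4,5) yR2] by blast
  have tube: "\<forall>\<^sub>F \<nu> in sequentially. \<exists>\<tau>. poly_approx f y0 K P s \<nu> \<tau> \<and> (\<forall>t\<in>{0..real K}. norm (\<tau> t) \<le> R + 2)"
    by (rule approx_in_tube_exists[OF assms(1) s assms(4,5)]) (rule yR)
  have "\<forall>\<^sub>F \<nu> in sequentially. \<forall>n\<in>{1..K * \<nu>}.
      norm ((y (grid \<nu> n) - \<sigma> \<nu> (grid \<nu> n)) - (y (grid \<nu> (n - 1)) - \<sigma> \<nu> (grid \<nu> (n - 1)))) \<le> C * step \<nu> ^ (2 * s + 1) \<and>
      (\<forall>c\<in>{0..1}. norm (y (grid \<nu> (n - 1) + c * step \<nu>) - \<sigma> \<nu> (grid \<nu> (n - 1) + c * step \<nu>)) \<le> C * step \<nu> ^ (s + 1))"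
    using tube assms(6) eventually_step_le[OF h0]
  proof eventually_elim
    case (elim \<nu>)
    then obtain \<tau> where \<tau>: "poly_approx f y0 K P s \<nu> \<tau>" "\<forall>t\<in>{0..real K}. norm (\<tau> t) \<le> R + 2" by blast
    have "\<forall>t\<in>{0..real K}. \<tau> t = \<sigma> \<nu> t" using elim(2) \<tau>(1) by (simp add: unique_poly_approx_def)
    then have "\<forall>t\<in>{0..grid \<nu> (K * \<nu>)}. norm (\<sigma> \<nu> t) \<le> R + 2"
      using \<tau>(2) elim(3) grid_mult[of \<nu> K] by auto
    moreover have "approx_upto f y0 P s \<nu> (K * \<nu>) (\<sigma> \<nu>)"
      using elim(2) by (simp add: unique_poly_approx_def poly_approx_iff)
    ultimately have *: "\<forall>n<K * \<nu>. norm ((y (grid \<nu> (Suc n)) - \<sigma> \<nu> (grid \<nu> (Suc n))) - (y (grid \<nu> n) - \<sigma> \<nu> (grid \<nu> n))) \<le> C * step \<nu> ^ (2 * s + 1)"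
      "\<forall>n<K * \<nu>. \<forall>c\<in>{0..1}. norm (y (grid \<nu> n + c * step \<nu>) - \<sigma> \<nu> (grid \<nu> n + c * step \<nu>)) \<le> C * step \<nu> ^ (s + 1)"
      using err[of \<nu> "K * \<nu>" "\<sigma> \<nu>"] elim(3) unfolding error_bounded_def by auto
    show ?case
    proof
      fix n assume "n \<in> {1..K * \<nu>}"
      then have "n - 1 < K * \<nu>" "Suc (n - 1) = n" by auto
      then show "norm ((y (grid \<nu> n) - \<sigma> \<nu> (grid \<nu> n)) - (y (grid \<nu> (n - 1)) - \<sigma> \<nu> (grid \<nu> (n - 1)))) \<le> C * step \<nu> ^ (2 * s + 1) \<and>
        (\<forall>c\<in>{0..1}. norm (y (grid \<nu> (n - 1) + c * step \<nu>) - \<sigma> \<nu> (grid \<nu> (n - 1) + c * step \<nu>)) \<le> C * step \<nu> ^ (s + 1))"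
        using * by metis
    qed
  qed
  then show ?thesis
    by (intro conjI exI[of _ C]) (auto elim!: eventually_mono)
qed

end
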